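(* Let $\Gamma$ be a finitely generated group and let $L$ be a subgroup of $\Gamma$. Let $\{H_n\}$ be a lattice of finite index normal subgroups of $\Gamma$ such that $\bigcap H_n = 1$. Let $\widehat{\Gamma}_{(H_n)}$ be the profinite completion of $\Gamma$ with respect to $\{H_n\}$, and let $\widehat{L}_{(L\cap H_n)}$ be the profinite completion of $L$ with respect to $\{L \cap H_n\}$. Let $L$ act by left multiplication on each of $\widehat{\Gamma}_{(H_n)}$ and $\widehat{L}_{(L\cap H_n)}$, each equipped with its normalized Haar measure. Then $$\mathrm{Cost}(L, \widehat{\Gamma}_{(H_n)}) = \mathrm{Cost}(L, \widehat{L}_{(L\cap H_n)}).$$
   Context: A set of subgroups $\{H_n\}$ of a group is called a lattice if it is closed under finite intersections. The profinite completion of a group $G$ with respect to a lattice $\{N_n\}$ of finite index normal subgroups is the inverse limit $\widehat{G}_{(N_n)} = \varprojlim G/N_n$. It is a compact group, it carries a unique normalized Haar measure (total mass 1), and $G$ acts on it by left multiplication through the natural map $G \to \widehat{G}_{(N_n)}$, which is injective when $\bigcap N_n = 1$. A subgroup $L$ of $\Gamma$ acts on $\widehat{\Gamma}_{(H_n)}$ by restriction. Cost: Let a countable group $G$ act on a standard Borel probability space $(X,\mu)$ by measure preserving Borel automorphisms, and let $E = E_G^X \subseteq X\times X$ be the orbit equivalence relation: $xEy$ if there is $\gamma\in G$ with $y=\gamma x$. A Borel subgraph of $E$ is a directed graph on $X$ whose edge set is a Borel subset of $E$. A subgraph $S$ of $E$ spans $E$ if for any $(x,y)\in E$ with $x\ne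 y$ there is a path from $x$ to $y$ in $S$, i.e. a sequence $x=x_0,x_1,\dots,x_k=y$ in $X$ with $(x_i,x_{i+1})\in S$ or $(x_{i+1},x_i)\in S$ for $0\le i\le k-1$. A graphing of $E$ is a Borel subgraph of $E$ that spans $E$. The edge-measure of a Borel subgraph $S$ is $e(S)=\int_X \deg_S(x)\,d\mu$, where $\deg_S(x)=|\{y\in X \mid (x,y)\in S\}|$ (it may be infinite). Then $\mathrm{Cost}(E)=\mathrm{Cost}(G,X)=\inf e(S)$, the infimum being over all graphings $S$ of $E$. *)

theory Defs
  imports
    "HOL-Algebra.Group_Action"
    "HOL-Algebra.Generated_Groups"
    "HOL-Algebra.Product_Groups"
    "HOL-Probability.Probability"
begin

definition finitely_generated_group :: "('a, 'b) monoid_scheme \<Rightarrow> bool" where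
  "finitely_generated_group G \<longleftrightarrow>
     group G \<and> (\<exists>S. finite S \<and> S \<subseteq> carrier G \<and> generate G S = carrier G)"

definition subgroup_lattice :: "('a, 'b) monoid_scheme \<Rightarrow> 'a set set \<Rightarrow> bool" where
  "subgroup_lattice G \<H> \<longleftrightarrow>
     (\<forall>H\<in>\<H>. subgroup H G) \<and>
     (\<forall>F. F \<subseteq> \<H> \<longrightarrow> finite F \<longrightarrow> F \<noteq> {} \<longrightarrow> \<Inter>F \<in> \<H>)"

definition finite_index :: "('a, 'b) monoid_scheme \<Rightarrow> 'a set \<Rightarrow> bool" where
  "finite_index G H \<longleftrightarrow> finite (rcosets\<^bsub>G\<^esub> H)"

text \<open>
  The inverse limit is the set of compatible families of cosets. For \<open>N \<subseteq> M\<close> the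
  bonding map from \<open>G Mod N\<close> to \<open>G Mod M\<close> sends a coset \<open>N g\<close> to \<open>M g\<close>, which is the
  product set of \<open>M\<close> and \<open>N g\<close>.
\<close>

definition profinite_completion ::
  "('a, 'b) monoid_scheme \<Rightarrow> 'a set set \<Rightarrow> ('a set \<Rightarrow> 'a set) monoid" where
  "profinite_completion G \<N> =
     (product_group \<N> (\<lambda>N. G Mod N))
       \<lparr>carrier := {x \<in> carrier (product_group \<N> (\<lambda>N. G Mod N)).
                     \<forall>N\<in>\<N>. \<forall>M\<in>\<N>. N \<subseteq> M \<longrightarrow> x M = M <#>\<^bsub>G\<^esub> x N}\<rparr>"

definition profinite_topology ::
  "('a, 'b) monoid_scheme \<Rightarrow> 'a set set \<Rightarrow> ('a set \<Rightarrow> 'a set) topology" where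
  "profinite_topology G \<N> =
     subtopology (product_topology (\<lambda>N. discrete_topology (carrier (G Mod N))) \<N>)
       (carrier (profinite_completion G \<N>))"

definition to_completion ::
  "('a, 'b) monoid_scheme \<Rightarrow> 'a set set \<Rightarrow> 'a \<Rightarrow> ('a set \<Rightarrow> 'a set)" where
  "to_completion G \<N> g = (\<lambda>N\<in>\<N>. N #>\<^bsub>G\<^esub> g)"

definition completion_action ::
  "('a, 'b) monoid_scheme \<Rightarrow> 'a set set \<Rightarrow> 'a \<Rightarrow> ('a set \<Rightarrow> 'a set) \<Rightarrow> ('a set \<Rightarrow> 'a set)" where
  "completion_action G \<N> g =
     (\<lambda>x\<in>carrier (profinite_completion G \<N>).
        to_completion G \<N> g \<otimes>\<^bsub>profinite_completion G \<N>\<^esub> x)"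

definition borel_sets_of :: "'x topology \<Rightarrow> 'x set set" where
  "borel_sets_of T = sigma_sets (topspace T) {U. openin T U}"

text \<open>
  Normalized Haar measure of a compact Hausdorff group \<open>K\<close> with topology \<open>T\<close>. For a finite
  Borel measure on a compact Hausdorff space, outer regularity of all Borel sets already
  yields inner regularity.
\<close>

definition normalized_haar_measure ::
  "('x, 'y) monoid_scheme \<Rightarrow> 'x topology \<Rightarrow> 'x measure \<Rightarrow> bool" where
  "normalized_haar_measure K T \<mu> \<longleftrightarrow>
     space \<mu> = topspace T \<and> sets \<mu> = borel_sets_of T \<and> prob_space \<mu> \<and>
     (\<forall>k\<in>carrier K. \<forall>A\<in>sets \<mu>. emeasure \<mu> ((\<lambda>x. k \<otimes>\<^bsub>K\<^esub> x) ` A) = emeasure \<mu> A) \<and>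
     (\<forall>A\<in>sets \<mu>. emeasure \<mu> A = (INF U\<in>{U. openin T U \<and> A \<subseteq> U}. emeasure \<mu> U))"

definition orbit_relation ::
  "('g, 'b) monoid_scheme \<Rightarrow> ('g \<Rightarrow> 'x \<Rightarrow> 'x) \<Rightarrow> 'x set \<Rightarrow> ('x \<times> 'x) set" where
  "orbit_relation G \<phi> X = {(x, y). x \<in> X \<and> y \<in> X \<and> y \<in> orbit G \<phi> x}"

text \<open>
  The measurable sets of \<open>M\<close> are meant to be the Borel sets of a standard Borel space, so
  that those of \<open>M \<Otimes>\<^sub>M M\<close> are the Borel sets of the square.
\<close>

definition borel_subgraph :: "'x measure \<Rightarrow> ('x \<times> 'x) set \<Rightarrow> ('x \<times> 'x) set \<Rightarrow> bool" where
  "borel_subgraph M E S \<longleftrightarrow> S \<subseteq> E \<and> S \<in> sets (M \<Otimes>\<^sub>M M)"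

definition spans :: "('x \<times> 'x) set \<Rightarrow> ('x \<times> 'x) set \<Rightarrow> bool" where
  "spans S E \<longleftrightarrow> (\<forall>x y. (x, y) \<in> E \<longrightarrow> x \<noteq> y \<longrightarrow> (x, y) \<in> (S \<union> S\<inverse>)\<^sup>*)"

definition graphing :: "'x measure \<Rightarrow> ('x \<times> 'x) set \<Rightarrow> ('x \<times> 'x) set \<Rightarrow> bool" where
  "graphing M E S \<longleftrightarrow> borel_subgraph M E S \<and> spans S E"

definition out_degree :: "'x measure \<Rightarrow> ('x \<times> 'x) set \<Rightarrow> 'x \<Rightarrow> ennreal" where
  "out_degree M S x = emeasure (count_space (space M)) {y \<in> space M. (x, y) \<in> S}"

definition edge_measure :: "'x measure \<Rightarrow> ('x \<times> 'x) set \<Rightarrow> ennreal" where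
  "edge_measure M S = (\<integral>\<^sup>+ x. out_degree M S x \<partial>M)"

definition cost_of_relation :: "'x measure \<Rightarrow> ('x \<times> 'x) set \<Rightarrow> ennreal" where
  "cost_of_relation M E = (INF S\<in>{S. graphing M E S}. edge_measure M S)"

definition cost :: "('g, 'b) monoid_scheme \<Rightarrow> ('g \<Rightarrow> 'x \<Rightarrow> 'x) \<Rightarrow> 'x measure \<Rightarrow> ennreal" where
  "cost G \<phi> M = cost_of_relation M (orbit_relation G \<phi> (space M))"

end

theory Submission
  imports Defs
begin

text \<open>
  Graphings pull back along measurable equivariant maps of free actions, and out-degrees are
  preserved. Let \<open>K\<close> be the completion of \<open>L\<close>, which embeds in the completion \<open>X\<close> of \<open>\<Gamma>\<close> as the
  closure of \<open>L\<close>. A continuous \<open>L\<close>-equivariant map \<open>X \<rightarrow> K\<close>, obtained from a section of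
  the quotient of \<open>X\<close> by \<open>K\<close>, carries \<open>\<mu>\<close> to \<open>\<nu>\<close> by uniqueness of the \<open>L\<close>-invariant probability measure on \<open>K\<close>;
  pulling back along it gives \<open>\<le>\<close>. Conversely, a graphing on \<open>X\<close> pulls back along
  \<open>k \<mapsto> k x\<close> for every \<open>x\<close>, and by Fubini and the invariance of \<open>\<mu>\<close> the edge measures of these
  pullbacks have average equal to the edge measure on \<open>X\<close>, so that some \<open>x\<close> does not exceed it.
  Finite generation enters because it makes the lattice countable, hence \<open>X\<close> metrizable.
\<close>

section \<open>Finite index subgroups of finitely generated groups\<close>

context group
begin

lemma countable_generate:
  assumes "countable S"
  shows "countable (generate G S)"
proof -
  \<comment> \<open>Stage 0 holds the generators, their inverses and the identity; each later stage
    adds all products of pairs. The stages increase, so elements found at different stages meet at a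
    common one and can be multiplied there.\<close>
  define P where "P = (\<lambda>n. rec_nat (S \<union> m_inv G ` S \<union> {\<one>}) (\<lambda>_ A. (\<lambda>(x, y). x \<otimes> y) ` (A \<times> A) \<union> A) n)"
  have P0: "P 0 = S \<union> m_inv G ` S \<union> {\<one>}"
    and PS: "P (Suc n) = (\<lambda>(x, y). x \<otimes> y) ` (P n \<times> P n) \<union> P n" for n
    by (auto simp: P_def)
  have mono: "P m \<subseteq> P n" if "m \<le> n" for m n
    using that by (induction n rule: dec_induct) (auto simp: PS)
  have "countable (P n)" for n
    by (induction n) (use assms in \<open>auto simp: P0 PS\<close>)
  moreover have "generate G S \<subseteq> (\<Union>n. P n)"
  proof
    fix x assume "x \<in> generate G S"
    then show "x \<in> (\<Union>n. P n)"
    proof induction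
      case (eng a b)
      then obtain m n where "a \<in> P m" "b \<in> P n" by blast
      then have "a \<in> P (max m n)" "b \<in> P (max m n)"
        using mono[of m "max m n"] mono[of n "max m n"] by auto
      then have "a \<otimes> b \<in> P (Suc (max m n))" by (force simp: PS)
      then show ?case by blast
    qed (use P0 in blast)+
  qed
  ultimately show ?thesis
    by (meson countable_UN countableI_type countable_subset)
qed

text \<open>The generators of the finite index subgroup are those of Schreier, together with the
  representative of the trivial coset, which need not be chosen to be the identity.\<close>

lemma finite_index_subgroup_finitely_generated:
  assumes S: "finite S" "S \<subseteq> carrier G" "generate G S = carrier G"
    and H: "subgroup H G" and fin: "finite_index G H"
  shows "\<exists>F. finite F \<and> F \<subseteq> carrier G \<and> H = generate G F"
proof -
  interpret H: subgroup H G by (fact H)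
  \<comment> \<open>\<open>T\<close> meets every right coset of \<open>H\<close> and is finite
    because the index is.\<close>
  define T where "T = (\<lambda>c. SOME g. g \<in> c) ` (rcosets H)"
  have "finite T"
    using fin by (simp add: T_def finite_index_def)
  have rep: "\<exists>t\<in>T. t \<in> H #> g" if "g \<in> carrier G" for g
  proof -
    have "(SOME x. x \<in> H #> g) \<in> H #> g"
      using rcos_self[OF that H] by (rule someI)
    moreover have "H #> g \<in> rcosets H"
      using that by (auto simp: RCOSETS_def)
    ultimately show ?thesis unfolding T_def by blast
  qed
  have T_carr: "T \<subseteq> carrier G"
  proof
    fix t assume "t \<in> T"
    then obtain g where g: "g \<in> carrier G" "t = (SOME x. x \<in> H #> g)"
      by (auto simp: T_def RCOSETS_def)
    have "t \<in> H #> g"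
      unfolding g(2) using rcos_self[OF g(1) H] by (rule someI)
    then show "t \<in> carrier G"
      using r_coset_subset_G[OF H.subset g(1)] by blast
  qed
  define S' where "S' = S \<union> m_inv G ` S"
  have S': "S' \<subseteq> carrier G" "finite S'"
    using S by (auto simp: S'_def)
  define F where "F = H \<inter> ((\<lambda>(t, s, u). t \<otimes> s \<otimes> inv u) ` (T \<times> S' \<times> T) \<union> T)"
  have "finite F"
    using \<open>finite T\<close> S' by (simp add: F_def)
  have "F \<subseteq> H" by (auto simp: F_def)
  have gen_sub: "generate G F \<subseteq> H"
    using generate_subgroup_incl[OF \<open>F \<subseteq> H\<close> H] .
  have gen_carr: "h \<in> carrier G" if "h \<in> generate G F" for h
    using that gen_sub H.subset by blast
  \<comment> \<open>These products turn out to be the whole group: \<open>Z\<close> is stable under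
    right multiplication by \<open>S\<close> and its inverses, and it contains the identity.\<close>
  define Z where "Z = {h \<otimes> t |h t. h \<in> generate G F \<and> t \<in> T}"
  have step: "z \<otimes> s \<in> Z" if "z \<in> Z" "s \<in> S'" for z s
  proof -
    obtain h t where ht: "z = h \<otimes> t" "h \<in> generate G F" "t \<in> T"
      using \<open>z \<in> Z\<close> by (auto simp: Z_def)
    have carr: "h \<in> carrier G" "t \<in> carrier G" "s \<in> carrier G"
      using ht gen_sub T_carr S' that by auto
    \<comment> \<open>\<open>u\<close> represents the coset of \<open>t \<otimes> s\<close>, so
      \<open>t \<otimes> s \<otimes> inv u\<close> lies in \<open>H\<close> and is a Schreier
      generator; moving it into the left factor leaves \<open>u\<close> as the new
      representative.\<close>
    obtain u where u: "u \<in> T" "u \<in> H #> (t \<otimes> s)"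
      using rep[of "t \<otimes> s"] carr by auto
    have u_carr: "u \<in> carrier G" using u T_carr by auto
    obtain h' where h': "h' \<in> H" "u = h' \<otimes> (t \<otimes> s)"
      using u(2) by (auto simp: r_coset_def)
    have "t \<otimes> s \<otimes> inv u = inv h'"
      using h' carr H.mem_carrier[OF h'(1)] by (simp add: inv_mult_group m_assoc [symmetric])
       (simp add: m_assoc r_inv)
    then have "t \<otimes> s \<otimes> inv u \<in> H" using h' by auto
    then have "t \<otimes> s \<otimes> inv u \<in> F"
      using ht u that unfolding F_def by force
    then have "h \<otimes> (t \<otimes> s \<otimes> inv u) \<in> generate G F"
      using ht by (auto intro: generate.intros)
    moreover have "z \<otimes> s = h \<otimes> (t \<otimes> s \<otimes> inv u) \<otimes> u"
      using carr u_carr ht by (simp add: m_assoc)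
    ultimately show ?thesis using u by (auto simp: Z_def)
  qed
  have "z \<otimes> g \<in> Z" if "g \<in> generate G S" "z \<in> Z" for g z
    using that
  proof (induction arbitrary: z)
    case one
    then have "z \<in> carrier G" using gen_carr T_carr by (auto simp: Z_def)
    then show ?case using one by simp
  next
    case (eng a b)
    moreover have "z \<in> carrier G" "a \<in> carrier G" "b \<in> carrier G"
      using eng S gen_carr T_carr by (auto simp: Z_def)
    ultimately show ?case using eng.IH(2)[OF eng.IH(1)[OF eng.prems]] by (simp add: m_assoc)
  qed (use step in \<open>auto simp: S'_def\<close>)
  moreover obtain t0 where t0: "t0 \<in> T" "t0 \<in> H"
    using rep[OF one_closed] H.subset by (auto simp: coset_mult_one)
  have "t0 \<in> F" using t0 by (auto simp: F_def)
  have "inv t0 \<in> generate G F"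
    using \<open>t0 \<in> F\<close> by (rule generate.inv)
  then have "inv t0 \<otimes> t0 \<in> Z"
    using t0 unfolding Z_def by blast
  then have "\<one> \<in> Z" using t0 T_carr by auto
  ultimately have Z_all: "g \<in> Z" if "g \<in> carrier G" for g
    using that S by (metis l_one)
  have "H \<subseteq> generate G F"
  proof
    fix x assume x: "x \<in> H"
    then obtain h t where ht: "x = h \<otimes> t" "h \<in> generate G F" "t \<in> T"
      using Z_all[of x] by (auto simp: Z_def)
    \<comment> \<open>A product \<open>h \<otimes> t\<close> in \<open>H\<close> with
      \<open>h\<close> in \<open>H\<close> forces \<open>t\<close> into \<open>H\<close>, and
      \<open>F\<close> contains every element of \<open>T\<close> lying in \<open>H\<close>.\<close>
    have "h \<in> H" "t \<in> carrier G" using ht gen_sub T_carr by auto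
    then have "t = inv h \<otimes> x" using ht by (simp add: m_assoc [symmetric])
    then have "t \<in> H" using x \<open>h \<in> H\<close> by simp
    then have "t \<in> F" using ht by (auto simp: F_def)
    then show "x \<in> generate G F" using ht by (auto intro: generate.intros)
  qed
  then show ?thesis
    using gen_sub \<open>finite F\<close> \<open>F \<subseteq> H\<close> H.subset by blast
qed

text \<open>Each such subgroup is generated by a finite subset of a countable group, and there are
  only countably many finite subsets.\<close>

lemma countable_finite_index_subgroups:
  assumes "finitely_generated_group G"
  shows "countable {H. subgroup H G \<and> finite_index G H}"
proof -
  obtain S where S: "finite S" "S \<subseteq> carrier G" "generate G S = carrier G"
    using assms by (auto simp: finitely_generated_group_def)
  then have "countable (carrier G)"
    using countable_generate[of S] by (simp add: countable_finite)
  then have "countable {F. F \<subseteq> carrier G \<and> finite F}"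
    using countable_Collect_finite_subset[of "carrier G"] by (simp add: conj_commute)
  moreover have "{H. subgroup H G \<and> finite_index G H} \<subseteq> generate G ` {F. F \<subseteq> carrier G \<and> finite F}"
    using finite_index_subgroup_finitely_generated[OF S] by blast
  ultimately show ?thesis
    by (meson countable_image countable_subset)
qed

end

section \<open>Graphings of free actions\<close>

text \<open>Measurability of the graphs is an axiom because it can fail over an arbitrary measurable
  space: for the identity it says that the diagonal is measurable. Completions satisfy it by
  countability of the lattice.\<close>

locale free_measurable_action = group G for G (structure) +
  fixes \<phi> :: "'a \<Rightarrow> 'x \<Rightarrow> 'x" and M :: "'x measure"
  assumes countable_carrier: "countable (carrier G)"
    and act_measurable: "g \<in> carrier G \<Longrightarrow> \<phi> g \<in> M \<rightarrow>\<^sub>M M"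
    and act_one: "x \<in> space M \<Longrightarrow> \<phi> \<one> x = x"
    and act_mult: "g \<in> carrier G \<Longrightarrow> h \<in> carrier G \<Longrightarrow> x \<in> space M \<Longrightarrow> \<phi> (g \<otimes> h) x = \<phi> g (\<phi> h x)"
    and act_free: "g \<in> carrier G \<Longrightarrow> h \<in> carrier G \<Longrightarrow> x \<in> space M \<Longrightarrow> \<phi> g x = \<phi> h x \<Longrightarrow> g = h"
    and sets_graph: "g \<in> carrier G \<Longrightarrow> {(x, y). x \<in> space M \<and> y = \<phi> g x} \<in> sets (M \<Otimes>\<^sub>M M)"
begin

lemma act_closed: "g \<in> carrier G \<Longrightarrow> x \<in> space M \<Longrightarrow> \<phi> g x \<in> space M"
  using act_measurable by (auto dest: measurable_space)

abbreviation "E \<equiv> orbit_relation G \<phi> (space M)"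

lemma orbit_relation_iff: "(x, y) \<in> E \<longleftrightarrow> x \<in> space M \<and> (\<exists>g\<in>carrier G. y = \<phi> g x)"
  by (auto simp: orbit_relation_def orbit_def act_closed)

lemma sets_orbit_relation: "E \<in> sets (M \<Otimes>\<^sub>M M)"
proof -
  have "E = (\<Union>g\<in>carrier G. {(x, y). x \<in> space M \<and> y = \<phi> g x})"
    using orbit_relation_iff by auto
  also have "\<dots> \<in> sets (M \<Otimes>\<^sub>M M)"
    using countable_carrier sets_graph by (intro sets.countable_UN') auto
  finally show ?thesis .
qed

text \<open>Freeness lets the neighbours of \<open>x\<close> be counted by group elements. The index
  set then no longer depends on the point or on the space, which gives measurability of the degree
  and its comparison along equivariant maps.\<close>

lemma out_degree_eq_count:
  assumes "S \<subseteq> E" "x \<in> space M"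
  shows "out_degree M S x = (\<integral>\<^sup>+g. indicator S (x, \<phi> g x) \<partial>count_space (carrier G))"
proof -
  let ?A = "{g \<in> carrier G. (x, \<phi> g x) \<in> S}" and ?B = "{y \<in> space M. (x, y) \<in> S}"
  have "bij_betw (\<lambda>g. \<phi> g x) ?A ?B"
    unfolding bij_betw_def
  proof
    show "inj_on (\<lambda>g. \<phi> g x) ?A"
      using act_free assms(2) by (auto intro!: inj_onI)
    show "(\<lambda>g. \<phi> g x) ` ?A = ?B"
      using assms act_closed orbit_relation_iff by fastforce
  qed
  \<comment> \<open>Counting measure is infinite on every infinite set, so finiteness has to be
    transported along with the cardinality.\<close>
  then have "finite ?A = finite ?B" "card ?A = card ?B"
    by (auto simp: bij_betw_finite bij_betw_same_card)
  then have "out_degree M S x = emeasure (count_space (carrier G)) ?A"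
    unfolding out_degree_def by (simp add: emeasure_count_space)
  also have "\<dots> = (\<integral>\<^sup>+g. indicator ?A g \<partial>count_space (carrier G))"
    by simp
  also have "\<dots> = (\<integral>\<^sup>+g. indicator S (x, \<phi> g x) \<partial>count_space (carrier G))"
    by (intro nn_integral_cong) (auto simp: indicator_def)
  finally show ?thesis .
qed

lemma out_degree_measurable:
  assumes "S \<subseteq> E" "S \<in> sets (M \<Otimes>\<^sub>M M)"
  shows "out_degree M S \<in> borel_measurable M"
proof -
  interpret sigma_finite_measure "count_space (carrier G)"
    using countable_carrier by (rule sigma_finite_measure_count_space_countable)
  have "(\<lambda>p. indicator S (fst p, \<phi> (snd p) (fst p)) :: ennreal)
      \<in> borel_measurable (M \<Otimes>\<^sub>M count_space (carrier G))"
  proof (rule measurable_compose_countable'[where f="\<lambda>g p. indicator S (fst p, \<phi> g (fst p))" and g=snd])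
    fix g assume g: "g \<in> carrier G"
    note act_measurable[OF g, measurable]
    show "(\<lambda>p. indicator S (fst p, \<phi> g (fst p)) :: ennreal)
        \<in> borel_measurable (M \<Otimes>\<^sub>M count_space (carrier G))"
      using assms(2) by measurable
  qed (use countable_carrier in auto)
  then have "(\<lambda>x. \<integral>\<^sup>+g. indicator S (x, \<phi> g x) \<partial>count_space (carrier G)) \<in> borel_measurable M"
    by (intro borel_measurable_nn_integral) (simp add: case_prod_unfold)
  then show ?thesis
    by (subst measurable_cong[OF out_degree_eq_count[OF assms(1)]])
qed

end

section \<open>Pulling graphings back along equivariant maps\<close>

locale equivariant_map =
  source: free_measurable_action G \<phi> M + target: free_measurable_action G \<psi> N
  for G (structure) and \<phi> :: "'a \<Rightarrow> 'x \<Rightarrow> 'x" and M and \<psi> :: "'a \<Rightarrow> 'y \<Rightarrow> 'y" and N +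
  fixes \<pi> :: "'x \<Rightarrow> 'y"
  assumes map_measurable[measurable]: "\<pi> \<in> M \<rightarrow>\<^sub>M N"
    and equivariant: "g \<in> carrier G \<Longrightarrow> x \<in> space M \<Longrightarrow> \<pi> (\<phi> g x) = \<psi> g (\<pi> x)"
begin

text \<open>The intersection with \<open>source.E\<close> matters: an equivariant map may send
  different orbits to the same one, and edges between such orbits must be excluded.\<close>

definition pullback :: "('y \<times> 'y) set \<Rightarrow> ('x \<times> 'x) set" where
  "pullback S = {(x, y) \<in> source.E. (\<pi> x, \<pi> y) \<in> S}"

lemma map_space: "x \<in> space M \<Longrightarrow> \<pi> x \<in> space N"
  using map_measurable by (rule measurable_space)

lemma pullback_act_iff:
  "x \<in> space M \<Longrightarrow> g \<in> carrier G \<Longrightarrow> (x, \<phi> g x) \<in> pullback S \<longleftrightarrow> (\<pi> x, \<psi> g (\<pi> x)) \<in> S"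
  by (auto simp: pullback_def source.orbit_relation_iff equivariant)

text \<open>By equivariance, the same group elements give edges at \<open>x\<close> and at its
  image, so both degrees count the same set.\<close>

lemma out_degree_pullback:
  assumes "S \<subseteq> target.E" "x \<in> space M"
  shows "out_degree M (pullback S) x = out_degree N S (\<pi> x)"
proof -
  have "pullback S \<subseteq> source.E" by (auto simp: pullback_def)
  then show ?thesis
    using assms map_space
    by (auto simp: source.out_degree_eq_count target.out_degree_eq_count pullback_act_iff
        indicator_def intro!: nn_integral_cong)
qed

lemma edge_measure_pullback:
  assumes "S \<subseteq> target.E"
  shows "edge_measure M (pullback S) = (\<integral>\<^sup>+x. out_degree N S (\<pi> x) \<partial>M)"
  unfolding edge_measure_def using out_degree_pullback[OF assms] by (rule nn_integral_cong)

text \<open>A path in the target is lifted edge by edge: its vertices are translates of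
  \<open>\<pi> x\<close>, and the translate by \<open>h\<close> is lifted to
  \<open>\<phi> h x\<close>. Freeness in the target ensures that the lift ends at the intended
  point.\<close>

lemma spans_pullback:
  assumes "S \<subseteq> target.E" "spans S target.E"
  shows "spans (pullback S) source.E"
  unfolding spans_def
proof (intro allI impI)
  fix x y assume "(x, y) \<in> source.E" "x \<noteq> y"
  then obtain g where g: "x \<in> space M" "g \<in> carrier G" "y = \<phi> g x"
    by (auto simp: source.orbit_relation_iff)
  have "(\<pi> x, \<psi> g (\<pi> x)) \<in> target.E"
    using g map_space by (auto simp: target.orbit_relation_iff)
  then have path: "(\<pi> x, \<psi> g (\<pi> x)) \<in> (S \<union> S\<inverse>)\<^sup>*"
    using assms(2) by (cases "\<pi> x = \<psi> g (\<pi> x)") (auto simp: spans_def)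
  have lift: "\<exists>h\<in>carrier G. z = \<psi> h (\<pi> x) \<and> (x, \<phi> h x) \<in> (pullback S \<union> (pullback S)\<inverse>)\<^sup>*"
    if "(\<pi> x, z) \<in> (S \<union> S\<inverse>)\<^sup>*" for z
    using that
  proof induction
    case base
    show ?case
      using g map_space by (auto intro!: bexI[of _ \<one>] simp: source.act_one target.act_one)
  next
    case (step u v)
    then obtain h where h: "h \<in> carrier G" "u = \<psi> h (\<pi> x)"
      "(x, \<phi> h x) \<in> (pullback S \<union> (pullback S)\<inverse>)\<^sup>*" by blast
    have hx: "\<phi> h x \<in> space M" "\<pi> (\<phi> h x) = u"
      using h g source.act_closed equivariant by auto
    have "\<exists>k\<in>carrier G. v = \<psi> k u"
    proof (cases "(u, v) \<in> S")
      case True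
      then show ?thesis using assms(1) target.orbit_relation_iff by blast
    next
      case False
      then have "(v, u) \<in> target.E" using step(2) assms(1) by blast
      then obtain k where k: "v \<in> space N" "k \<in> carrier G" "u = \<psi> k v"
        by (auto simp: target.orbit_relation_iff)
      then have "v = \<psi> (inv k) u"
        using target.act_mult[of "inv k" k v] target.act_one by simp
      then show ?thesis using k by blast
    qed
    then obtain k where k: "k \<in> carrier G" "v = \<psi> k u" by blast
    let ?w = "\<phi> (k \<otimes> h) x"
    have w: "?w = \<phi> k (\<phi> h x)" "v = \<psi> (k \<otimes> h) (\<pi> x)" "?w \<in> space M" "\<pi> ?w = v"
      using k h g hx map_space
      by (auto simp: source.act_mult target.act_mult source.act_closed equivariant)
    \<comment> \<open>The edge of \<open>S\<close> may be traversed backwards, so the lifted pair is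
      needed in the orbit relation in both orders.\<close>
    have "\<phi> h x = \<phi> (inv k) ?w"
      using k hx source.act_mult[of "inv k" k "\<phi> h x"] w by (simp add: source.act_one)
    then have "(\<phi> h x, ?w) \<in> source.E" "(?w, \<phi> h x) \<in> source.E"
      using k hx w by (auto simp: source.orbit_relation_iff)
    then have "(\<phi> h x, ?w) \<in> pullback S \<union> (pullback S)\<inverse>"
      using step(2) hx w by (auto simp: pullback_def)
    then show ?case
      using h k w by (intro bexI[of _ "k \<otimes> h"]) (auto intro: rtrancl_into_rtrancl)
  qed
  obtain h where "h \<in> carrier G" "\<psi> g (\<pi> x) = \<psi> h (\<pi> x)"
    "(x, \<phi> h x) \<in> (pullback S \<union> (pullback S)\<inverse>)\<^sup>*"
    using lift[OF path] by blast
  \<comment> \<open>Both \<open>g\<close> and \<open>h\<close> carry \<open>\<pi> x\<close> to the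
    same point, hence \<open>h\<close> equals \<open>g\<close> and the lifted path ends at
    \<open>y\<close>.\<close>
  then show "(x, y) \<in> (pullback S \<union> (pullback S)\<inverse>)\<^sup>*"
    using g map_space target.act_free by metis
qed

lemma graphing_pullback:
  assumes "graphing N target.E S"
  shows "graphing M source.E (pullback S)"
proof -
  have S: "S \<subseteq> target.E" "S \<in> sets (N \<Otimes>\<^sub>M N)" "spans S target.E"
    using assms by (auto simp: graphing_def borel_subgraph_def)
  have "(\<lambda>p. (\<pi> (fst p), \<pi> (snd p))) \<in> (M \<Otimes>\<^sub>M M) \<rightarrow>\<^sub>M (N \<Otimes>\<^sub>M N)"
    by measurable
  then have "(\<lambda>p. (\<pi> (fst p), \<pi> (snd p))) -` S \<inter> space (M \<Otimes>\<^sub>M M) \<in> sets (M \<Otimes>\<^sub>M M)"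
    using S(2) by (rule measurable_sets)
  moreover have "pullback S = source.E \<inter> ((\<lambda>p. (\<pi> (fst p), \<pi> (snd p))) -` S \<inter> space (M \<Otimes>\<^sub>M M))"
    using source.sets_orbit_relation[THEN sets.sets_into_space] by (auto simp: pullback_def)
  ultimately have "pullback S \<in> sets (M \<Otimes>\<^sub>M M)"
    using source.sets_orbit_relation by auto
  then show ?thesis
    using spans_pullback[OF S(1,3)] by (auto simp: graphing_def borel_subgraph_def pullback_def)
qed

text \<open>The bound is kept as an integral over the source, with no relation between the two
  measures, so that it also applies to maps which do not carry one measure to the other.\<close>

lemma cost_le_of_graphing:
  assumes "graphing N target.E S"
  shows "cost G \<phi> M \<le> (\<integral>\<^sup>+x. out_degree N S (\<pi> x) \<partial>M)"
proof -
  have "S \<subseteq> target.E" using assms by (auto simp: graphing_def borel_subgraph_def)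
  then show ?thesis
    unfolding cost_def cost_of_relation_def
    using graphing_pullback[OF assms] by (auto simp flip: edge_measure_pullback intro!: INF_lower)
qed

theorem cost_le_of_measure_preserving:
  assumes "distr M N \<pi> = N"
  shows "cost G \<phi> M \<le> cost G \<psi> N"
  unfolding cost_def[of G \<psi>] cost_of_relation_def
proof (rule INF_greatest)
  fix S assume "S \<in> {S. graphing N target.E S}"
  then have S: "graphing N target.E S" "S \<subseteq> target.E" "S \<in> sets (N \<Otimes>\<^sub>M N)"
    by (auto simp: graphing_def borel_subgraph_def)
  have "out_degree N S \<in> borel_measurable (distr M N \<pi>)"
    using target.out_degree_measurable[OF S(2,3)] by simp
  then have "(\<integral>\<^sup>+x. out_degree N S (\<pi> x) \<partial>M) = (\<integral>\<^sup>+y. out_degree N S y \<partial>distr M N \<pi>)"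
    by (subst nn_integral_distr) auto
  then show "cost G \<phi> M \<le> edge_measure N S"
    using cost_le_of_graphing[OF S(1)] by (simp add: assms edge_measure_def)
qed

end

section \<open>Averaging over a family of equivariant maps\<close>

lemma (in prob_space) exists_le_nn_integral:
  assumes "f \<in> borel_measurable M"
  shows "\<exists>x\<in>space M. f x \<le> (\<integral>\<^sup>+y. f y \<partial>M)"
proof (rule ccontr)
  assume *: "\<not> ?thesis"
  let ?c = "\<integral>\<^sup>+y. f y \<partial>M"
  have less: "?c < f x" if "x \<in> space M" for x
    using * that by (auto simp: not_le)
  \<comment> \<open>The space is nonempty, so the average lies strictly below some value; its
    finiteness is what makes the comparison of integrals strict.\<close>
  then have "?c \<noteq> \<infinity>"
    using not_empty by fastforce
  then have "(\<integral>\<^sup>+x. ?c \<partial>M) < (\<integral>\<^sup>+x. f x \<partial>M)"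
    using assms less
  proof (intro nn_integral_less)
    show "\<not> (AE x in M. f x \<le> ?c)"
    proof
      assume "AE x in M. f x \<le> ?c"
      with AE_space have "AE x in M. False"
        by eventually_elim (use less in \<open>auto simp: not_le[symmetric]\<close>)
      then show False by simp
    qed
  qed (auto simp: emeasure_space_1 less_imp_le)
  then show False by (simp add: emeasure_space_1)
qed

text \<open>For fixed \<open>x\<close> the map \<open>\<lambda>k. a k x\<close> is equivariant but
  may distort measure; for fixed \<open>k\<close> the map \<open>a k\<close> preserves measure.
  Fubini exchanges the two roles: averaged over \<open>x\<close>, the pullbacks of a graphing have
  the edge measure of that graphing, and some \<open>x\<close> does at least as well as the
  average.\<close>

theorem cost_le_of_equivariant_family:
  assumes "prob_space M" "prob_space N"
    and equiv: "\<And>x. x \<in> space N \<Longrightarrow> equivariant_map G \<phi> M \<psi> N (\<lambda>k. a k x)"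
    and meas: "(\<lambda>p. a (fst p) (snd p)) \<in> (M \<Otimes>\<^sub>M N) \<rightarrow>\<^sub>M N"
    and inv: "\<And>k. k \<in> space M \<Longrightarrow> distr N N (a k) = N"
  shows "cost G \<phi> M \<le> cost G \<psi> N"
  unfolding cost_def[of G \<psi>] cost_of_relation_def
proof (rule INF_greatest)
  interpret M: prob_space M by fact
  interpret N: prob_space N by fact
  interpret pair_sigma_finite M N ..
  \<comment> \<open>The free action on \<open>N\<close> is given only through members of the family,
    so a point is needed to extract it.\<close>
  obtain x0 where "x0 \<in> space N" using N.not_empty by blast
  then interpret N: free_measurable_action G \<psi> N
    using equiv by (auto simp: equivariant_map_def)
  fix S assume "S \<in> {S. graphing N (orbit_relation G \<psi> (space N)) S}"
  then have S: "graphing N N.E S" "S \<subseteq> N.E" "S \<in> sets (N \<Otimes>\<^sub>M N)"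
    by (auto simp: graphing_def borel_subgraph_def)
  have deg[measurable]: "out_degree N S \<in> borel_measurable N"
    using N.out_degree_measurable[OF S(2,3)] .
  let ?f = "\<lambda>k x. out_degree N S (a k x)"
  have f[measurable]: "(\<lambda>p. ?f (fst p) (snd p)) \<in> borel_measurable (M \<Otimes>\<^sub>M N)"
    using measurable_compose[OF meas deg] .
  have a[measurable]: "a k \<in> N \<rightarrow>\<^sub>M N" if "k \<in> space M" for k
    using measurable_compose[OF measurable_Pair1'[OF that] meas] by simp
  have "(\<integral>\<^sup>+x. \<integral>\<^sup>+k. ?f k x \<partial>M \<partial>N) = (\<integral>\<^sup>+k. \<integral>\<^sup>+x. ?f k x \<partial>N \<partial>M)"
    by (rule Fubini') (use f in \<open>simp add: case_prod_unfold\<close>)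
  also have "\<dots> = (\<integral>\<^sup>+k. edge_measure N S \<partial>M)"
  proof (rule nn_integral_cong)
    fix k assume k: "k \<in> space M"
    have "(\<integral>\<^sup>+x. ?f k x \<partial>N) = (\<integral>\<^sup>+x. out_degree N S x \<partial>distr N N (a k))"
      using a[OF k] deg by (subst nn_integral_distr) auto
    then show "(\<integral>\<^sup>+x. ?f k x \<partial>N) = edge_measure N S"
      by (simp add: inv[OF k] edge_measure_def)
  qed
  also have "\<dots> = edge_measure N S" by (simp add: M.emeasure_space_1)
  finally have total: "(\<integral>\<^sup>+x. \<integral>\<^sup>+k. ?f k x \<partial>M \<partial>N) = edge_measure N S" .
  have "(\<lambda>x. \<integral>\<^sup>+k. ?f k x \<partial>M) \<in> borel_measurable N"
    by (rule M.borel_measurable_nn_integral)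
       (use measurable_compose[OF measurable_pair_swap' f] in \<open>simp add: case_prod_unfold\<close>)
  \<comment> \<open>The point depends on \<open>S\<close>, which is harmless because each graphing
    is bounded separately before the infimum is taken.\<close>
  then obtain x where x: "x \<in> space N" "(\<integral>\<^sup>+k. ?f k x \<partial>M) \<le> edge_measure N S"
    using N.exists_le_nn_integral total by metis
  interpret equivariant_map G \<phi> M \<psi> N "\<lambda>k. a k x"
    using x(1) by (rule equiv)
  show "cost G \<phi> M \<le> edge_measure N S"
    using cost_le_of_graphing[OF S(1)] x(2) by (rule order_trans)
qed

section \<open>Profinite completions and Haar measure\<close>

lemma (in group) rcos_eq_iff:
  assumes "subgroup N G" "g \<in> carrier G" "h \<in> carrier G"
  shows "N #> g = N #> h \<longleftrightarrow> g \<in> N #> h"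
  using assms by (metis rcos_self repr_independence)

lemma (in group) mem_rcos_iff:
  assumes "subgroup N G" "g \<in> carrier G" "h \<in> carrier G"
  shows "g \<in> N #> h \<longleftrightarrow> g \<otimes> inv h \<in> N"
  using assms by (metis subgroup.rcos_module is_group)

text \<open>This computes the bonding maps on representatives. With \<open>L \<inter> H\<close>
  inside \<open>H\<close> it also computes the map from the completion of the subgroup.\<close>

lemma (in group) set_mult_rcos:
  assumes "subgroup M G" "N \<subseteq> M" "\<one> \<in> N" "g \<in> carrier G"
  shows "M <#> (N #> g) = M #> g"
proof -
  interpret M: subgroup M G by fact
  have "M <#> N = M"
    using assms by (force simp: set_mult_def)
  then show ?thesis
    using setmult_rcos_assoc[of M N g] assms M.subset by auto
qed

lemma (in group) rcosets_countable:
  assumes "countable (carrier G)"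
  shows "countable (rcosets N)"
proof -
  have "rcosets N = (\<lambda>g. N #> g) ` carrier G" by (auto simp: RCOSETS_def)
  then show ?thesis using assms by simp
qed

section \<open>The inverse limit through coset representatives, and the action on it\<close>

locale normal_lattice = group G for G (structure) +
  fixes \<N> :: "'a set set"
  assumes lattice: "subgroup_lattice G \<N>"
    and normal: "N \<in> \<N> \<Longrightarrow> N \<lhd> G"
    and finite_index: "N \<in> \<N> \<Longrightarrow> finite_index G N"
    and nonempty: "\<N> \<noteq> {}"
    and countable: "countable \<N>"
    and countable_group: "countable (carrier G)"
    and separating: "carrier G \<inter> \<Inter>\<N> = {\<one>}"
begin

abbreviation "X \<equiv> carrier (profinite_completion G \<N>)"

lemma subgrp: "N \<in> \<N> \<Longrightarrow> subgroup N G"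
  using normal by (simp add: normal_imp_subgroup)

lemma Inter_in: "F \<subseteq> \<N> \<Longrightarrow> finite F \<Longrightarrow> F \<noteq> {} \<Longrightarrow> \<Inter>F \<in> \<N>"
  using lattice by (auto simp: subgroup_lattice_def)

lemma Int_in: "N \<in> \<N> \<Longrightarrow> M \<in> \<N> \<Longrightarrow> N \<inter> M \<in> \<N>"
  using Inter_in[of "{N, M}"] by auto

lemma set_mult_coset:
  "N \<in> \<N> \<Longrightarrow> M \<in> \<N> \<Longrightarrow> N \<subseteq> M \<Longrightarrow> g \<in> carrier G \<Longrightarrow> M <#> (N #> g) = M #> g"
  using subgrp by (intro set_mult_rcos) (auto intro: subgroup.one_closed)

lemma mem_completion:
  "x \<in> X \<longleftrightarrow> x \<in> extensional \<N> \<and> (\<forall>N\<in>\<N>. x N \<in> rcosets N) \<and>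
     (\<forall>N\<in>\<N>. \<forall>M\<in>\<N>. N \<subseteq> M \<longrightarrow> x M = M <#> x N)"
  by (auto simp: profinite_completion_def PiE_def FactGroup_def Pi_iff)

lemma completion_extensional: "x \<in> X \<Longrightarrow> x \<in> extensional \<N>"
  unfolding mem_completion by blast

lemma completion_rcosets: "x \<in> X \<Longrightarrow> N \<in> \<N> \<Longrightarrow> x N \<in> rcosets N"
  unfolding mem_completion by blast

lemma completion_compatible:
  "x \<in> X \<Longrightarrow> N \<in> \<N> \<Longrightarrow> M \<in> \<N> \<Longrightarrow> N \<subseteq> M \<Longrightarrow> x M = M <#> x N"
  unfolding mem_completion by blast

text \<open>Compatibility propagates a representative of the coordinate at \<open>N\<close> to all
  coordinates above \<open>N\<close>. Computations in the completion thereby reduce to computations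
  with single group elements.\<close>

lemma completion_rep:
  assumes "x \<in> X" "N \<in> \<N>"
  shows "\<exists>g\<in>carrier G. \<forall>M\<in>\<N>. N \<subseteq> M \<longrightarrow> x M = M #> g"
proof -
  obtain g where g: "g \<in> carrier G" "x N = N #> g"
    using completion_rcosets[OF assms] by (auto simp: RCOSETS_def)
  have "x M = M #> g" if "M \<in> \<N>" "N \<subseteq> M" for M
    unfolding completion_compatible[OF assms that] g(2) using assms(2) that g(1) by (rule set_mult_coset)
  then show ?thesis using g(1) by blast
qed

lemma completion_rep_coset: "x \<in> X \<Longrightarrow> N \<in> \<N> \<Longrightarrow> \<exists>g\<in>carrier G. x N = N #> g"
  using completion_rep[of x N] by blast

lemma completionI:
  assumes "x \<in> extensional \<N>"
    and "\<And>N. N \<in> \<N> \<Longrightarrow> \<exists>g\<in>carrier G. \<forall>M\<in>\<N>. N \<subseteq> M \<longrightarrow> x M = M #> g"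
  shows "x \<in> X"
  unfolding mem_completion
proof (intro conjI ballI impI)
  fix N assume N: "N \<in> \<N>"
  then obtain g where g: "g \<in> carrier G" "\<forall>M\<in>\<N>. N \<subseteq> M \<longrightarrow> x M = M #> g"
    using assms(2) by blast
  then show "x N \<in> rcosets N" using N by (auto simp: RCOSETS_def)
  fix M assume "M \<in> \<N>" "N \<subseteq> M"
  then show "x M = M <#> x N" using g N set_mult_coset by simp
qed (fact assms)

lemma completion_eqI:
  assumes "x \<in> X" "y \<in> X" "\<And>N. N \<in> \<N> \<Longrightarrow> x N = y N"
  shows "x = y"
  using assms by (intro extensionalityI[of _ \<N>]) (auto simp: completion_extensional)

lemma mult_completion: "x \<otimes>\<^bsub>profinite_completion G \<N>\<^esub> y = (\<lambda>N\<in>\<N>. x N <#> y N)"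
  by (simp add: profinite_completion_def product_group_def)

lemma mult_closed:
  assumes "x \<in> X" "y \<in> X"
  shows "x \<otimes>\<^bsub>profinite_completion G \<N>\<^esub> y \<in> X"
proof (rule completionI)
  fix N assume N: "N \<in> \<N>"
  obtain g where g: "g \<in> carrier G" "\<And>M. M \<in> \<N> \<Longrightarrow> N \<subseteq> M \<Longrightarrow> x M = M #> g"
    using completion_rep[OF assms(1) N] by blast
  obtain h where h: "h \<in> carrier G" "\<And>M. M \<in> \<N> \<Longrightarrow> N \<subseteq> M \<Longrightarrow> y M = M #> h"
    using completion_rep[OF assms(2) N] by blast
  show "\<exists>g\<in>carrier G. \<forall>M\<in>\<N>. N \<subseteq> M \<longrightarrow> (x \<otimes>\<^bsub>profinite_completion G \<N>\<^esub> y) M = M #> g"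
    using g h normal.rcos_sum[OF normal] by (intro bexI[of _ "g \<otimes> h"]) (auto simp: mult_completion)
qed (simp add: mult_completion)

lemma to_completion_closed: "g \<in> carrier G \<Longrightarrow> to_completion G \<N> g \<in> X"
  by (rule completionI) (auto simp: to_completion_def)

lemma action_closed:
  "g \<in> carrier G \<Longrightarrow> x \<in> X \<Longrightarrow> completion_action G \<N> g x \<in> X"
  using mult_closed to_completion_closed by (auto simp: completion_action_def)

lemma action_apply:
  assumes "g \<in> carrier G" "x \<in> X" "N \<in> \<N>"
  shows "completion_action G \<N> g x N = (N #> g) <#> x N"
  using assms by (simp add: completion_action_def mult_completion to_completion_def)

lemma action_coset:
  assumes "g \<in> carrier G" "x \<in> X" "N \<in> \<N>" "h \<in> carrier G" "x N = N #> h"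
  shows "completion_action G \<N> g x N = N #> (g \<otimes> h)"
  using assms by (simp add: action_apply normal.rcos_sum[OF normal])

lemma action_one:
  assumes "x \<in> X"
  shows "completion_action G \<N> \<one> x = x"
proof (rule completion_eqI)
  fix N assume N: "N \<in> \<N>"
  obtain h where h: "h \<in> carrier G" "x N = N #> h"
    using completion_rep_coset[OF assms N] by blast
  then show "completion_action G \<N> \<one> x N = x N"
    using action_coset[OF one_closed assms N h] by simp
qed (use assms action_closed in auto)

lemma action_mult:
  assumes "g \<in> carrier G" "h \<in> carrier G" "x \<in> X"
  shows "completion_action G \<N> (g \<otimes> h) x = completion_action G \<N> g (completion_action G \<N> h x)"
proof (rule completion_eqI)
  fix N assume N: "N \<in> \<N>"
  obtain k where k: "k \<in> carrier G" "x N = N #> k"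
    using completion_rep_coset[OF assms(3) N] by blast
  have "completion_action G \<N> h x N = N #> (h \<otimes> k)"
    using assms N k by (intro action_coset)
  then have "completion_action G \<N> g (completion_action G \<N> h x) N = N #> (g \<otimes> (h \<otimes> k))"
    using assms N k by (intro action_coset) (auto simp: action_closed)
  moreover have "completion_action G \<N> (g \<otimes> h) x N = N #> (g \<otimes> h \<otimes> k)"
    using assms N k by (intro action_coset) auto
  ultimately show "completion_action G \<N> (g \<otimes> h) x N = completion_action G \<N> g (completion_action G \<N> h x) N"
    using assms k by (simp add: m_assoc)
qed (use assms action_closed in auto)

text \<open>Equality of the coordinates at \<open>N\<close> puts \<open>g \<otimes> inv h\<close>
  into \<open>N\<close>, because the representative \<open>k\<close> of the point cancels; the
  members of the lattice meet only in the identity.\<close>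

lemma action_free:
  assumes g: "g \<in> carrier G" and h: "h \<in> carrier G" and x: "x \<in> X"
    and eq: "completion_action G \<N> g x = completion_action G \<N> h x"
  shows "g = h"
proof -
  have "g \<otimes> inv h \<in> N" if N: "N \<in> \<N>" for N
  proof -
    obtain k where k: "k \<in> carrier G" "x N = N #> k"
      using completion_rep_coset[OF x N] by blast
    have "N #> (g \<otimes> k) = N #> (h \<otimes> k)"
      using action_coset[OF g x N k] action_coset[OF h x N k] eq by simp
    then have "(g \<otimes> k) \<otimes> inv (h \<otimes> k) \<in> N"
      using g h k subgrp[OF N] by (simp add: rcos_eq_iff mem_rcos_iff)
    moreover have "(g \<otimes> k) \<otimes> inv (h \<otimes> k) = g \<otimes> inv h"
      using g h k by (simp add: inv_mult_group m_assoc) (simp add: m_assoc[symmetric])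
    ultimately show ?thesis by simp
  qed
  then have "g \<otimes> inv h \<in> carrier G \<inter> \<Inter>\<N>" using g h by auto
  then show ?thesis
    using separating g h by (metis inv_equality inv_inv inv_closed singletonD)
qed

section \<open>Cylinder sets as a countable base\<close>

definition cylinder :: "'a set \<Rightarrow> 'a set \<Rightarrow> ('a set \<Rightarrow> 'a set) set" where
  "cylinder N c = {x \<in> X. x N = c}"

text \<open>The empty set is included so that the family is closed under intersection, as uniqueness
  of measures on a generator requires.\<close>

definition cylinders :: "('a set \<Rightarrow> 'a set) set set" where
  "cylinders = insert {} {cylinder N c |N c. N \<in> \<N> \<and> c \<in> rcosets N}"

lemma topspace_profinite: "topspace (profinite_topology G \<N>) = X"
  by (auto simp: profinite_topology_def profinite_completion_def)

lemma openin_cylinder: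
  assumes "N \<in> \<N>"
  shows "openin (profinite_topology G \<N>) (cylinder N c)"
proof -
  let ?T = "product_topology (\<lambda>N. discrete_topology (carrier (G Mod N))) \<N>"
  have "openin ?T {x \<in> topspace ?T. x N \<in> {c} \<inter> carrier (G Mod N)}"
    using assms by (intro openin_continuous_map_preimage[OF continuous_map_product_projection]) auto
  moreover have "cylinder N c = {x \<in> topspace ?T. x N \<in> {c} \<inter> carrier (G Mod N)} \<inter> X"
    using assms by (auto simp: cylinder_def profinite_completion_def PiE_def Pi_iff)
  ultimately show ?thesis
    unfolding profinite_topology_def openin_subtopology by blast
qed

text \<open>A basic open set of the product restricts finitely many coordinates, and all of these
  are determined by the single coordinate at the intersection of the subgroups concerned.\<close>

lemma openin_profinite_cylinder:
  assumes "openin (profinite_topology G \<N>) U" "x \<in> U"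
  shows "\<exists>N\<in>\<N>. cylinder N (x N) \<subseteq> U"
proof -
  let ?T = "product_topology (\<lambda>N. discrete_topology (carrier (G Mod N))) \<N>"
  obtain V where V: "openin ?T V" "U = V \<inter> X"
    using assms(1) by (auto simp: profinite_topology_def openin_subtopology)
  with assms(2) obtain W where W: "finite {N \<in> \<N>. W N \<noteq> carrier (G Mod N)}"
      "x \<in> Pi\<^sub>E \<N> W" "Pi\<^sub>E \<N> W \<subseteq> V"
    by (auto simp: openin_product_topology_alt)
  have x: "x \<in> X" using assms(2) V by blast
  obtain N0 where "N0 \<in> \<N>" using nonempty by blast
  \<comment> \<open>\<open>N0\<close> keeps \<open>F\<close> nonempty when no coordinate is
    restricted, so that its intersection is a member of the lattice.\<close>
  define F where "F = insert N0 {N \<in> \<N>. W N \<noteq> carrier (G Mod N)}"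
  have "F \<subseteq> \<N>" "finite F" "F \<noteq> {}"
    using W(1) \<open>N0 \<in> \<N>\<close> by (auto simp: F_def)
  then have F: "F \<subseteq> \<N>" "\<Inter>F \<in> \<N>"
    using Inter_in by auto
  have "cylinder (\<Inter>F) (x (\<Inter>F)) \<subseteq> U"
  proof
    fix y assume y: "y \<in> cylinder (\<Inter>F) (x (\<Inter>F))"
    then have yX: "y \<in> X" "y (\<Inter>F) = x (\<Inter>F)" by (auto simp: cylinder_def)
    have agree: "y M = x M" if "M \<in> F" for M
    proof -
      have "\<Inter>F \<subseteq> M" "M \<in> \<N>" using that F by auto
      then show ?thesis using F(2) yX completion_compatible[OF x] completion_compatible[OF yX(1)] by metis
    qed
    have "y N \<in> W N" if "N \<in> \<N>" for N
    proof (cases "N \<in> F")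
      case True
      then show ?thesis using agree W(2) that by auto
    next
      case False
      then have "W N = carrier (G Mod N)" using that by (auto simp: F_def)
      then show ?thesis using that yX(1) by (auto simp: completion_rcosets FactGroup_def)
    qed
    then have "y \<in> Pi\<^sub>E \<N> W"
      using yX(1) completion_extensional by (auto simp: PiE_def)
    then show "y \<in> U" using V W(3) yX by blast
  qed
  then show ?thesis using F by blast
qed

lemma countable_cylinders: "countable cylinders"
proof -
  have "cylinders = insert {} ((\<lambda>(N, c). cylinder N c) ` (SIGMA N:\<N>. rcosets N))"
    by (auto simp: cylinders_def)
  then show ?thesis
    using countable rcosets_countable[OF countable_group] by auto
qed

lemma cylinders_subset: "cylinders \<subseteq> Pow X"
  by (auto simp: cylinders_def cylinder_def)

text \<open>An open set is the union of the cylinders it contains, and there are only countably many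
  cylinders.\<close>

lemma borel_sets_profinite: "borel_sets_of (profinite_topology G \<N>) = sigma_sets X cylinders"
  unfolding borel_sets_of_def topspace_profinite
proof (rule sigma_sets_eqI)
  interpret sigma_algebra X "sigma_sets X cylinders"
    by (rule sigma_algebra_sigma_sets[OF cylinders_subset])
  fix U assume "U \<in> {U. openin (profinite_topology G \<N>) U}"
  then have U: "openin (profinite_topology G \<N>) U" by simp
  have "U = \<Union>{C \<in> cylinders. C \<subseteq> U}"
  proof
    show "U \<subseteq> \<Union>{C \<in> cylinders. C \<subseteq> U}"
    proof
      fix x assume x: "x \<in> U"
      then have "x \<in> X" using openin_subset[OF U] topspace_profinite by auto
      obtain N where N: "N \<in> \<N>" "cylinder N (x N) \<subseteq> U"
        using openin_profinite_cylinder[OF U x] by blast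
      then have "cylinder N (x N) \<in> cylinders"
        using completion_rcosets[OF \<open>x \<in> X\<close>] unfolding cylinders_def by blast
      moreover have "x \<in> cylinder N (x N)"
        using \<open>x \<in> X\<close> by (simp add: cylinder_def)
      ultimately show "x \<in> \<Union>{C \<in> cylinders. C \<subseteq> U}" using N by blast
    qed
  qed auto
  also have "\<dots> \<in> sigma_sets X cylinders"
    using countable_cylinders countable_subset[of "{C \<in> cylinders. C \<subseteq> U}" cylinders]
    by (intro countable_Union) auto
  finally show "U \<in> sigma_sets X cylinders" .
next
  fix C assume "C \<in> cylinders"
  then show "C \<in> sigma_sets X {U. openin (profinite_topology G \<N>) U}"
    using openin_cylinder by (auto simp: cylinders_def sigma_sets.Empty)
qed

text \<open>Two cylinders with a common point \<open>x\<close> meet in the cylinder of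
  \<open>x\<close> at \<open>N \<inter> M\<close>: if representatives \<open>g\<close> and
  \<open>h\<close> agree modulo \<open>N\<close> and modulo \<open>M\<close>, then
  \<open>g \<otimes> inv h\<close> lies in both subgroups.\<close>

lemma Int_stable_cylinders: "Int_stable cylinders"
proof (rule Int_stableI)
  fix A B assume AB: "A \<in> cylinders" "B \<in> cylinders"
  show "A \<inter> B \<in> cylinders"
  proof (cases "A \<inter> B = {}")
    case True
    then show ?thesis by (simp add: cylinders_def)
  next
    case False
    then obtain x where x: "x \<in> A" "x \<in> B" by blast
    then obtain N M where NM: "N \<in> \<N>" "M \<in> \<N>" "A = cylinder N (x N)" "B = cylinder M (x M)" "x \<in> X"
      using AB by (auto simp: cylinders_def cylinder_def)
    have "A \<inter> B = cylinder (N \<inter> M) (x (N \<inter> M))"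
    proof
      show "cylinder (N \<inter> M) (x (N \<inter> M)) \<subseteq> A \<inter> B"
      proof
        fix y assume "y \<in> cylinder (N \<inter> M) (x (N \<inter> M))"
        then have y: "y \<in> X" "y (N \<inter> M) = x (N \<inter> M)" by (auto simp: cylinder_def)
        have "y K = x K" if "K \<in> \<N>" "N \<inter> M \<subseteq> K" for K
          using completion_compatible[OF y(1) Int_in[OF NM(1,2)] that] y(2)
            completion_compatible[OF NM(5) Int_in[OF NM(1,2)] that] by argo
        then show "y \<in> A \<inter> B" using NM y(1) by (auto simp: cylinder_def)
      qed
      show "A \<inter> B \<subseteq> cylinder (N \<inter> M) (x (N \<inter> M))"
      proof
        fix y assume "y \<in> A \<inter> B"
        then have y: "y \<in> X" "y N = x N" "y M = x M" using NM by (auto simp: cylinder_def)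
        obtain g where g: "g \<in> carrier G" "\<And>K. K \<in> \<N> \<Longrightarrow> N \<inter> M \<subseteq> K \<Longrightarrow> x K = K #> g"
          using completion_rep[OF NM(5) Int_in[OF NM(1,2)]] by blast
        obtain h where h: "h \<in> carrier G" "\<And>K. K \<in> \<N> \<Longrightarrow> N \<inter> M \<subseteq> K \<Longrightarrow> y K = K #> h"
          using completion_rep[OF y(1) Int_in[OF NM(1,2)]] by blast
        have "g \<otimes> inv h \<in> N" "g \<otimes> inv h \<in> M"
          using g(2)[of N] h(2)[of N] g(2)[of M] h(2)[of M] y NM g(1) h(1) subgrp
          by (auto simp: mem_rcos_iff[symmetric] rcos_eq_iff[symmetric])
        then have "x (N \<inter> M) = y (N \<inter> M)"
          using g h NM Int_in[OF NM(1,2)] subgrp[OF Int_in[OF NM(1,2)]]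
          by (simp add: mem_rcos_iff rcos_eq_iff)
        then show "y \<in> cylinder (N \<inter> M) (x (N \<inter> M))" using y by (simp add: cylinder_def)
      qed
    qed
    then show ?thesis
      using Int_in[OF NM(1,2)] completion_rcosets[OF NM(5)] unfolding cylinders_def by blast
  qed
qed

end

section \<open>Haar measure: measurability, invariance and uniqueness\<close>

locale haar_lattice = normal_lattice +
  fixes \<mu>
  assumes haar: "normalized_haar_measure (profinite_completion G \<N>) (profinite_topology G \<N>) \<mu>"
begin

sublocale prob_space \<mu>
  using haar by (simp add: normalized_haar_measure_def)

lemma space_haar: "space \<mu> = X"
  using haar by (simp add: normalized_haar_measure_def topspace_profinite)

lemma sets_haar: "sets \<mu> = sigma_sets X cylinders"
  using haar by (simp add: normalized_haar_measure_def borel_sets_profinite)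

lemma sets_cylinder: "N \<in> \<N> \<Longrightarrow> c \<in> rcosets N \<Longrightarrow> cylinder N c \<in> sets \<mu>"
  by (auto simp: sets_haar cylinders_def)

lemma coordinate_measurable:
  assumes "N \<in> \<N>"
  shows "(\<lambda>x. x N) \<in> \<mu> \<rightarrow>\<^sub>M count_space (rcosets N)"
proof (subst measurable_count_space_eq_countable)
  show "(\<lambda>x. x N) \<in> space \<mu> \<rightarrow> rcosets N \<and> (\<forall>a\<in>rcosets N. (\<lambda>x. x N) -` {a} \<inter> space \<mu> \<in> sets \<mu>)"
  proof (intro conjI ballI)
    fix c assume c: "c \<in> rcosets N"
    have "(\<lambda>x. x N) -` {c} \<inter> space \<mu> = cylinder N c"
      by (auto simp: cylinder_def space_haar)
    then show "(\<lambda>x. x N) -` {c} \<inter> space \<mu> \<in> sets \<mu>" using sets_cylinder assms c by simp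
  qed (use assms in \<open>auto simp: space_haar completion_rcosets\<close>)
qed (rule rcosets_countable[OF countable_group])

lemma measurable_haarI:
  assumes "\<And>z. z \<in> space Z \<Longrightarrow> f z \<in> X"
    and "\<And>N. N \<in> \<N> \<Longrightarrow> (\<lambda>z. f z N) \<in> Z \<rightarrow>\<^sub>M count_space (rcosets N)"
  shows "f \<in> Z \<rightarrow>\<^sub>M \<mu>"
proof (rule measurable_sigma_sets[OF sets_haar cylinders_subset])
  show "f \<in> space Z \<rightarrow> X" using assms(1) by auto
  fix C assume "C \<in> cylinders"
  then consider "C = {}" | N c where "N \<in> \<N>" "c \<in> rcosets N" "C = cylinder N c"
    by (auto simp: cylinders_def)
  then show "f -` C \<inter> space Z \<in> sets Z"
  proof cases
    case 2
    have "f -` C \<inter> space Z = (\<lambda>z. f z N) -` {c} \<inter> space Z"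
      using assms(1) 2(3) by (auto simp: cylinder_def)
    also have "\<dots> \<in> sets Z"
      using assms(2)[OF 2(1)] 2(2) by (auto intro: measurable_sets)
    finally show ?thesis .
  qed auto
qed

lemma mult_measurable:
  "(\<lambda>p. fst p \<otimes>\<^bsub>profinite_completion G \<N>\<^esub> snd p) \<in> (\<mu> \<Otimes>\<^sub>M \<mu>) \<rightarrow>\<^sub>M \<mu>"
proof (rule measurable_haarI)
  fix N assume N: "N \<in> \<N>"
  note coordinate_measurable[OF N, measurable]
  \<comment> \<open>The second coordinate takes countably many values, so it may be held constant
    and only the first one varied.\<close>
  have "(\<lambda>p. (\<lambda>c. fst p N <#> c) (snd p N)) \<in> (\<mu> \<Otimes>\<^sub>M \<mu>) \<rightarrow>\<^sub>M count_space (rcosets N)"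
  proof (rule measurable_compose_countable'[where f="\<lambda>c p. fst p N <#> c" and g="\<lambda>p. snd p N"])
    fix c assume c: "c \<in> rcosets N"
    have "(\<lambda>b. b <#> c) \<in> count_space (rcosets N) \<rightarrow>\<^sub>M count_space (rcosets N)"
      using normal.setmult_closed[OF normal[OF N]] c by auto
    then show "(\<lambda>p. fst p N <#> c) \<in> (\<mu> \<Otimes>\<^sub>M \<mu>) \<rightarrow>\<^sub>M count_space (rcosets N)"
      by (rule measurable_compose[rotated]) measurable
  qed (auto intro: rcosets_countable countable_group)
  then show "(\<lambda>p. (fst p \<otimes>\<^bsub>profinite_completion G \<N>\<^esub> snd p) N) \<in> (\<mu> \<Otimes>\<^sub>M \<mu>) \<rightarrow>\<^sub>M count_space (rcosets N)"
    using N by (simp add: mult_completion)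
qed (auto simp: space_pair_measure space_haar mult_closed)

lemma mult_left_measurable:
  assumes "k \<in> X"
  shows "(\<lambda>x. k \<otimes>\<^bsub>profinite_completion G \<N>\<^esub> x) \<in> \<mu> \<rightarrow>\<^sub>M \<mu>"
proof -
  have "(\<lambda>x. (k, x)) \<in> \<mu> \<rightarrow>\<^sub>M \<mu> \<Otimes>\<^sub>M \<mu>"
    using assms by (intro measurable_Pair1') (simp add: space_haar)
  from measurable_compose[OF this mult_measurable] show ?thesis by simp
qed

text \<open>Invariance is assumed for images; for preimages the inequality obtained directly
  becomes an equality by passing to complements.\<close>

lemma distr_mult_left:
  assumes k: "k \<in> X"
  shows "distr \<mu> \<mu> (\<lambda>x. k \<otimes>\<^bsub>profinite_completion G \<N>\<^esub> x) = \<mu>"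
proof (rule measure_eqI)
  let ?m = "\<lambda>x. k \<otimes>\<^bsub>profinite_completion G \<N>\<^esub> x"
  note m[measurable] = mult_left_measurable[OF k]
  have le: "prob (?m -` A \<inter> space \<mu>) \<le> prob A" if A[measurable]: "A \<in> sets \<mu>" for A
  proof -
    have pre: "?m -` A \<inter> space \<mu> \<in> sets \<mu>" by measurable
    then have "emeasure \<mu> (?m -` A \<inter> space \<mu>) = emeasure \<mu> (?m ` (?m -` A \<inter> space \<mu>))"
      using haar k unfolding normalized_haar_measure_def by simp
    also have "\<dots> \<le> emeasure \<mu> A"
      by (rule emeasure_mono) (use A in auto)
    finally show ?thesis by (simp add: emeasure_eq_measure)
  qed
  fix A assume "A \<in> sets (distr \<mu> \<mu> ?m)"
  then have A[measurable]: "A \<in> sets \<mu>" by simp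
  have "?m -` (space \<mu> - A) \<inter> space \<mu> = space \<mu> - (?m -` A \<inter> space \<mu>)"
    using measurable_space[OF m] by auto
  moreover have "prob (space \<mu> - (?m -` A \<inter> space \<mu>)) = 1 - prob (?m -` A \<inter> space \<mu>)"
    by (rule prob_compl) measurable
  ultimately have "prob A \<le> prob (?m -` A \<inter> space \<mu>)"
    using le[of "space \<mu> - A"] A by (simp add: prob_compl)
  then show "emeasure (distr \<mu> \<mu> ?m) A = emeasure \<mu> A"
    using le[OF A] by (simp add: emeasure_distr emeasure_eq_measure)
qed simp

lemma action_eq_mult:
  "x \<in> space \<mu> \<Longrightarrow> completion_action G \<N> g x = to_completion G \<N> g \<otimes>\<^bsub>profinite_completion G \<N>\<^esub> x"
  by (simp add: completion_action_def space_haar)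

lemma action_measurable:
  "g \<in> carrier G \<Longrightarrow> completion_action G \<N> g \<in> \<mu> \<rightarrow>\<^sub>M \<mu>"
  by (subst measurable_cong[OF action_eq_mult])
    (auto intro!: mult_left_measurable to_completion_closed)

lemma distr_action:
  "g \<in> carrier G \<Longrightarrow> distr \<mu> \<mu> (completion_action G \<N> g) = \<mu>"
  by (subst distr_cong[OF refl refl action_eq_mult])
    (auto intro!: distr_mult_left to_completion_closed)

text \<open>Points are separated by countably many coordinates, each with countably many values. The
  graph is thus a countable intersection of countable unions of measurable sets.\<close>

lemma sets_action_graph:
  assumes "g \<in> carrier G"
  shows "{(x, y). x \<in> space \<mu> \<and> y = completion_action G \<N> g x} \<in> sets (\<mu> \<Otimes>\<^sub>M \<mu>)"
proof -
  note action_measurable[OF assms, measurable]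
  have "{(x, y). x \<in> space \<mu> \<and> y = completion_action G \<N> g x} =
      (\<Inter>N\<in>\<N>. {p \<in> space (\<mu> \<Otimes>\<^sub>M \<mu>). snd p N = completion_action G \<N> g (fst p) N})" (is "?L = ?R")
  proof
    show "?L \<subseteq> ?R"
      using assms by (auto simp: space_pair_measure space_haar action_closed)
    show "?R \<subseteq> ?L"
    proof
      fix p assume "p \<in> ?R"
      then have "fst p \<in> X" "snd p \<in> X" "\<And>N. N \<in> \<N> \<Longrightarrow> snd p N = completion_action G \<N> g (fst p) N"
        using nonempty by (auto simp: space_pair_measure space_haar)
      then have "snd p = completion_action G \<N> g (fst p)" "fst p \<in> X"
        using completion_eqI action_closed[OF assms] by auto
      then show "p \<in> ?L" by (cases p) (auto simp: space_haar)
    qed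
  qed
  also have "\<dots> \<in> sets (\<mu> \<Otimes>\<^sub>M \<mu>)"
  proof (rule sets.countable_INT'[OF countable nonempty], rule image_subsetI)
    fix N assume N: "N \<in> \<N>"
    note coordinate_measurable[OF N, measurable]
    have "{p \<in> space (\<mu> \<Otimes>\<^sub>M \<mu>). snd p N = completion_action G \<N> g (fst p) N} =
      (\<Union>c\<in>rcosets N. ((\<lambda>p. snd p N) -` {c} \<inter> space (\<mu> \<Otimes>\<^sub>M \<mu>)) \<inter>
         ((\<lambda>p. completion_action G \<N> g (fst p) N) -` {c} \<inter> space (\<mu> \<Otimes>\<^sub>M \<mu>)))"
      using completion_rcosets[OF action_closed[OF assms] N]
      by (auto simp: space_pair_measure space_haar)
    also have "\<dots> \<in> sets (\<mu> \<Otimes>\<^sub>M \<mu>)"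
    proof (rule sets.countable_UN'')
      fix c assume "c \<in> rcosets N"
      have "(\<lambda>p. snd p N) \<in> (\<mu> \<Otimes>\<^sub>M \<mu>) \<rightarrow>\<^sub>M count_space (rcosets N)"
        "(\<lambda>p. completion_action G \<N> g (fst p) N) \<in> (\<mu> \<Otimes>\<^sub>M \<mu>) \<rightarrow>\<^sub>M count_space (rcosets N)"
        by (rule measurable_compose[OF _ coordinate_measurable[OF N]], measurable)+
      from this[THEN measurable_sets, of "{c}"]
      show "((\<lambda>p. snd p N) -` {c} \<inter> space (\<mu> \<Otimes>\<^sub>M \<mu>)) \<inter>
         ((\<lambda>p. completion_action G \<N> g (fst p) N) -` {c} \<inter> space (\<mu> \<Otimes>\<^sub>M \<mu>)) \<in> sets (\<mu> \<Otimes>\<^sub>M \<mu>)"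
        using \<open>c \<in> rcosets N\<close> by simp
    qed (rule rcosets_countable[OF countable_group])
    finally show "{p \<in> space (\<mu> \<Otimes>\<^sub>M \<mu>). snd p N = completion_action G \<N> g (fst p) N} \<in> sets (\<mu> \<Otimes>\<^sub>M \<mu>)" .
  qed
  finally show ?thesis .
qed

lemma free_measurable_action_subgroup:
  assumes "subgroup L G"
  shows "free_measurable_action (G\<lparr>carrier := L\<rparr>) (completion_action G \<N>) \<mu>"
proof -
  interpret L: subgroup L G by fact
  interpret GL: group "G\<lparr>carrier := L\<rparr>"
    using L.subgroup_is_group[OF is_group] .
  show ?thesis
    by unfold_locales
      (auto simp: space_haar action_measurable action_one action_mult sets_action_graph[unfolded space_haar]
        intro: countable_subset[OF L.subset countable_group] action_free)
qed

text \<open>Invariance under the group itself, rather than its completion, suffices: the group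
  permutes the finitely many cylinders of each level transitively, so they have equal mass, and
  cylinders determine the measure.\<close>

lemma invariant_prob_unique:
  assumes P: "prob_space P" and sets: "sets P = sets \<mu>"
    and inv: "\<And>g. g \<in> carrier G \<Longrightarrow> distr P P (completion_action G \<N> g) = P"
  shows "P = \<mu>"
proof -
  have cylinder_value: "emeasure Q (cylinder N c) = 1 / of_nat (card (rcosets N))"
    if N: "N \<in> \<N>" and c: "c \<in> rcosets N" and Q: "prob_space Q" "sets Q = sets \<mu>"
      "\<And>g. g \<in> carrier G \<Longrightarrow> distr Q Q (completion_action G \<N> g) = Q" for Q N c
  proof -
    interpret Q: prob_space Q by fact
    have spQ: "space Q = X" using sets_eq_imp_space_eq[OF Q(2)] space_haar by simp
    have cyl: "cylinder N d \<in> sets Q" if "d \<in> rcosets N" for d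
      using sets_cylinder[OF N that] Q(2) by simp
    have eq: "emeasure Q (cylinder N (N #> g)) = emeasure Q (cylinder N N)" if g: "g \<in> carrier G" for g
    proof -
      have N_cos: "N #> g \<in> rcosets N" using g by (auto simp: RCOSETS_def)
      have meas: "completion_action G \<N> g \<in> Q \<rightarrow>\<^sub>M Q"
        using action_measurable[OF g] measurable_cong_sets[OF Q(2) Q(2)] by simp
      have "emeasure Q (cylinder N (N #> g)) = emeasure (distr Q Q (completion_action G \<N> g)) (cylinder N (N #> g))"
        using Q(3)[OF g] by simp
      also have "\<dots> = emeasure Q (completion_action G \<N> g -` cylinder N (N #> g) \<inter> space Q)"
        using meas cyl[OF N_cos] by (rule emeasure_distr)
      \<comment> \<open>By normality, \<open>g \<otimes> h\<close> lies in the coset of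
        \<open>g\<close> exactly when \<open>h\<close> lies in \<open>N\<close>.\<close>
      also have "completion_action G \<N> g -` cylinder N (N #> g) \<inter> space Q = cylinder N N"
      proof -
        have "completion_action G \<N> g x N = N #> g \<longleftrightarrow> x N = N" if x: "x \<in> X" for x
        proof -
          obtain h where h: "h \<in> carrier G" "x N = N #> h"
            using completion_rep_coset[OF x N] by blast
          have "N #> (g \<otimes> h) = N #> g \<longleftrightarrow> g \<otimes> h \<otimes> inv g \<in> N"
            using g h subgrp[OF N] by (simp add: rcos_eq_iff mem_rcos_iff)
          also have "\<dots> \<longleftrightarrow> h \<in> N"
          proof
            assume "g \<otimes> h \<otimes> inv g \<in> N"
            then have "inv g \<otimes> (g \<otimes> h \<otimes> inv g) \<otimes> g \<in> N"
              using normal.inv_op_closed1[OF normal[OF N]] g by blast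
            moreover have "inv g \<otimes> (g \<otimes> h \<otimes> inv g) \<otimes> g = h"
              using g h by (simp add: m_assoc) (simp add: m_assoc[symmetric])
            ultimately show "h \<in> N" by simp
          qed (use normal.inv_op_closed2[OF normal[OF N]] g in blast)
          also have "\<dots> \<longleftrightarrow> N #> h = N"
            using rcos_eq_iff[OF subgrp[OF N] h(1) one_closed] h subgrp[OF N] coset_mult_one[of N]
            by (simp add: subgroup.subset)
          finally show ?thesis using action_coset[OF g x N h] h by simp
        qed
        then show ?thesis using g by (auto simp: cylinder_def spQ action_closed)
      qed
      finally show ?thesis .
    qed
    have "1 = emeasure Q (\<Union>d\<in>rcosets N. cylinder N d)"
    proof -
      have "(\<Union>d\<in>rcosets N. cylinder N d) = space Q"
        using N by (auto simp: cylinder_def spQ completion_rcosets)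
      then show ?thesis using Q.emeasure_space_1 by simp
    qed
    also have "\<dots> = (\<Sum>d\<in>rcosets N. emeasure Q (cylinder N d))"
      using finite_index[OF N] cyl
      by (intro sum_emeasure[symmetric])
        (auto simp: finite_index_def disjoint_family_on_def cylinder_def)
    also have "\<dots> = (\<Sum>d\<in>rcosets N. emeasure Q (cylinder N N))"
      using eq by (intro sum.cong) (auto simp: RCOSETS_def)
    finally have one: "1 = of_nat (card (rcosets N)) * emeasure Q (cylinder N N)" by simp
    then have "card (rcosets N) \<noteq> 0" by (intro notI) simp
    have "emeasure Q (cylinder N c) = emeasure Q (cylinder N N)"
      using c eq by (auto simp: RCOSETS_def)
    also have "\<dots> = 1 / of_nat (card (rcosets N))"
      using \<open>card (rcosets N) \<noteq> 0\<close>
      by (subst one) (simp add: ennreal_mult_divide_eq mult.commute[of "of_nat _"])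
    finally show ?thesis .
  qed
  obtain N0 where N0: "N0 \<in> \<N>" using nonempty by blast
  interpret P: prob_space P by fact
  show ?thesis
  proof (rule measure_eqI_generator_eq_countable[OF Int_stable_cylinders cylinders_subset])
    fix C assume "C \<in> cylinders"
    then show "emeasure P C = emeasure \<mu> C"
      using cylinder_value[OF _ _ P sets inv] cylinder_value[OF _ _ prob_space_axioms refl distr_action]
      by (auto simp: cylinders_def)
  next
    show "\<Union>(cylinder N0 ` (rcosets N0)) = X"
      using N0 by (auto simp: cylinder_def completion_rcosets)
    show "countable (cylinder N0 ` (rcosets N0))"
      using rcosets_countable[OF countable_group] by simp
  qed (use N0 sets sets_haar in \<open>auto simp: cylinders_def\<close>)
qed

end

section \<open>The closure of a subgroup in the completion\<close>

lemma r_coset_carrier_update [simp]: "N #>\<^bsub>G\<lparr>carrier := L\<rparr>\<^esub> g = N #>\<^bsub>G\<^esub> g"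
  by (simp add: r_coset_def)

lemma set_mult_carrier_update [simp]: "A <#>\<^bsub>G\<lparr>carrier := L\<rparr>\<^esub> B = A <#>\<^bsub>G\<^esub> B"
  by (simp add: set_mult_def)

lemma rcosets_carrier_update: "rcosets\<^bsub>G\<lparr>carrier := L\<rparr>\<^esub> N = (\<lambda>g. N #>\<^bsub>G\<^esub> g) ` L"
  by (auto simp: RCOSETS_def)

lemma (in group) subgroup_Int_rcos:
  assumes "subgroup L G" "subgroup N G" "l \<in> L"
  shows "(L \<inter> N) #> l = L \<inter> (N #> l)"
proof -
  interpret L: subgroup L G by fact
  have l: "l \<in> carrier G" using assms by auto
  show ?thesis
  proof
    show "(L \<inter> N) #> l \<subseteq> L \<inter> (N #> l)"
      using assms by (auto simp: r_coset_def)
    show "L \<inter> (N #> l) \<subseteq> (L \<inter> N) #> l"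
    proof
      fix a assume a: "a \<in> L \<inter> (N #> l)"
      then obtain n where n: "n \<in> N" "a = n \<otimes> l" by (auto simp: r_coset_def)
      have "n \<in> carrier G" using n assms(2) subgroup.mem_carrier by metis
      then have "n = a \<otimes> inv l" using n l by (simp add: m_assoc)
      then have "n \<in> L" using a assms(3) by simp
      then show "a \<in> (L \<inter> N) #> l" using n by (auto simp: r_coset_def)
    qed
  qed
qed

lemma (in normal_lattice) restrict_subgroup:
  assumes "subgroup L G"
  shows "normal_lattice (G\<lparr>carrier := L\<rparr>) ((\<inter>) L ` \<N>)"
proof -
  interpret L: subgroup L G by fact
  have norm: "L \<inter> N \<lhd> G\<lparr>carrier := L\<rparr>" if "N \<in> \<N>" for N
    using normal_Int_subgroup[OF assms normal[OF that]] by (simp add: Int_commute)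
  have lattice_L: "subgroup_lattice (G\<lparr>carrier := L\<rparr>) ((\<inter>) L ` \<N>)"
    unfolding subgroup_lattice_def
  proof (intro conjI allI impI ballI)
    fix F assume F: "F \<subseteq> (\<inter>) L ` \<N>" "finite F" "F \<noteq> {}"
    then obtain F' where F': "F' \<subseteq> \<N>" "finite F'" "F = (\<inter>) L ` F'"
      by (meson finite_subset_image)
    with F have "F' \<noteq> {}" by auto
    have "\<Inter>F = L \<inter> \<Inter>F'" using F'(3) \<open>F' \<noteq> {}\<close> by auto
    moreover have "\<Inter>F' \<in> \<N>" using F' \<open>F' \<noteq> {}\<close> by (intro Inter_in)
    ultimately show "\<Inter>F \<in> (\<inter>) L ` \<N>" by (intro image_eqI)
  qed (use norm normal_imp_subgroup in blast)
  have index_L: "finite_index (G\<lparr>carrier := L\<rparr>) (L \<inter> N)" if N: "N \<in> \<N>" for N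
  proof -
    \<comment> \<open>The cosets of the trace in \<open>L\<close> are traces of cosets of
      \<open>N\<close>, so there are only finitely many.\<close>
    have "rcosets\<^bsub>G\<lparr>carrier := L\<rparr>\<^esub> (L \<inter> N) \<subseteq> (\<inter>) L ` (rcosets N)"
      unfolding rcosets_carrier_update
    proof (rule image_subsetI)
      fix l assume l: "l \<in> L"
      then have "N #> l \<in> rcosets N" by (auto simp: RCOSETS_def)
      then show "(L \<inter> N) #> l \<in> (\<inter>) L ` (rcosets N)"
        unfolding subgroup_Int_rcos[OF assms subgrp[OF N] l] by (rule imageI)
    qed
    then show ?thesis
      using finite_index[OF N] unfolding finite_index_def by (metis finite_surj)
  qed
  have "carrier (G\<lparr>carrier := L\<rparr>) \<inter> \<Inter> ((\<inter>) L ` \<N>) = {\<one>\<^bsub>G\<lparr>carrier := L\<rparr>\<^esub>}"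
    using separating L.one_closed L.subset nonempty by auto
  with norm lattice_L index_L show ?thesis
    using nonempty countable countable_subset[OF L.subset countable_group]
    by (intro normal_lattice.intro L.subgroup_is_group[OF is_group] normal_lattice_axioms.intro) auto
qed

section \<open>Mapping the completion of the subgroup into that of the group\<close>

locale subgroup_completion =
  haar_lattice G \<H> \<mu> +
  closure: haar_lattice "G\<lparr>carrier := L\<rparr>" "(\<inter>) L ` \<H>" \<nu> +
  L: subgroup L G
  for G (structure) and \<H> \<mu> L \<nu>
begin

abbreviation "act \<equiv> completion_action G \<H>"
abbreviation "act_L \<equiv> completion_action (G\<lparr>carrier := L\<rparr>) ((\<inter>) L ` \<H>)"

text \<open>Left translation acts on right cosets because \<open>H\<close> is normal.\<close>

lemma shift_coset:
  assumes "H \<in> \<H>" "l \<in> carrier G" "a \<in> carrier G" "b \<in> carrier G" "H #> a = H #> b"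
  shows "H #> (l \<otimes> a) = H #> (l \<otimes> b)"
  using assms normal.rcos_sum[OF normal] by metis

lemma trace_subgroup: "H \<in> \<H> \<Longrightarrow> subgroup (L \<inter> H) G"
  using subgroups_Inter_pair[OF L.subgroup_axioms subgrp] .

text \<open>The homomorphism of completions induced by the inclusion of \<open>L\<close>: the coset
  of \<open>l\<close> modulo \<open>L \<inter> H\<close> goes to the coset of \<open>l\<close>
  modulo \<open>H\<close>.\<close>

definition embed :: "('a set \<Rightarrow> 'a set) \<Rightarrow> ('a set \<Rightarrow> 'a set)" where
  "embed k = (\<lambda>H\<in>\<H>. H <#> k (L \<inter> H))"

lemma embed_coset:
  assumes "H \<in> \<H>" "l \<in> L" "k (L \<inter> H) = (L \<inter> H) #> l"
  shows "embed k H = H #> l"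
  using assms set_mult_rcos[OF subgrp[OF assms(1)], of "L \<inter> H"] subgroup.one_closed[OF trace_subgroup]
  by (simp add: embed_def)

lemma embed_closed:
  assumes k: "k \<in> closure.X"
  shows "embed k \<in> X"
proof (rule completionI)
  fix N assume N: "N \<in> \<H>"
  obtain l where l: "l \<in> L" "\<forall>M\<in>(\<inter>) L ` \<H>. L \<inter> N \<subseteq> M \<longrightarrow> k M = M #> l"
    using closure.completion_rep[OF k imageI[OF N]] by auto
  have "embed k M = M #> l" if M: "M \<in> \<H>" "N \<subseteq> M" for M
  proof -
    have "L \<inter> N \<subseteq> L \<inter> M" using M by blast
    with l(2) M(1) have "k (L \<inter> M) = (L \<inter> M) #> l" by simp
    with M(1) l(1) show ?thesis by (rule embed_coset)
  qed
  then show "\<exists>g\<in>carrier G. \<forall>M\<in>\<H>. N \<subseteq> M \<longrightarrow> embed k M = M #> g"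
    using L.mem_carrier[OF l(1)] by (intro bexI[of _ l]) auto
qed (simp add: embed_def)

lemma embed_measurable: "embed \<in> \<nu> \<rightarrow>\<^sub>M \<mu>"
proof (rule measurable_haarI)
  fix H assume H: "H \<in> \<H>"
  have "(\<lambda>c. H <#> c) \<in> count_space (rcosets\<^bsub>G\<lparr>carrier := L\<rparr>\<^esub> (L \<inter> H)) \<rightarrow>\<^sub>M count_space (rcosets H)"
    using set_mult_rcos[OF subgrp[OF H], of "L \<inter> H"] subgroup.one_closed[OF trace_subgroup[OF H]]
    by (auto simp: rcosets_carrier_update RCOSETS_def intro: L.mem_carrier)
  from measurable_compose[OF closure.coordinate_measurable[OF imageI[OF H]] this]
  show "(\<lambda>k. embed k H) \<in> \<nu> \<rightarrow>\<^sub>M count_space (rcosets H)"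
    using H by (simp add: embed_def)
qed (simp add: embed_closed closure.space_haar)

text \<open>Right multiplication by \<open>x\<close> commutes with the left action, so each
  \<open>x\<close> yields an equivariant map from the completion of \<open>L\<close>.\<close>

lemma embed_act:
  assumes "l \<in> L" "k \<in> closure.X" "x \<in> X"
  shows "embed (act_L l k) \<otimes>\<^bsub>profinite_completion G \<H>\<^esub> x =
    act l (embed k \<otimes>\<^bsub>profinite_completion G \<H>\<^esub> x)"
proof (rule completion_eqI)
  have l: "l \<in> carrier G" using assms by auto
  have lk: "act_L l k \<in> closure.X" using closure.action_closed assms by simp
  show "embed (act_L l k) \<otimes>\<^bsub>profinite_completion G \<H>\<^esub> x \<in> X"
    using lk assms by (intro mult_closed embed_closed)
  have kx: "embed k \<otimes>\<^bsub>profinite_completion G \<H>\<^esub> x \<in> X"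
    using assms by (intro mult_closed embed_closed)
  then show "act l (embed k \<otimes>\<^bsub>profinite_completion G \<H>\<^esub> x) \<in> X"
    using l by (intro action_closed)
  fix H assume H: "H \<in> \<H>"
  obtain a where a: "a \<in> L" "k (L \<inter> H) = (L \<inter> H) #> a"
    using closure.completion_rep_coset[OF assms(2) imageI[OF H]] by auto
  obtain g where g: "g \<in> carrier G" "x H = H #> g"
    using completion_rep_coset[OF assms(3) H] by blast
  have "act_L l k (L \<inter> H) = (L \<inter> H) #> (l \<otimes> a)"
    using closure.action_coset[OF _ assms(2) imageI[OF H], of l a] assms(1) a by simp
  then have "embed (act_L l k) H = H #> (l \<otimes> a)"
    using assms a H by (intro embed_coset) auto
  then have "(embed (act_L l k) \<otimes>\<^bsub>profinite_completion G \<H>\<^esub> x) H = H #> (l \<otimes> a \<otimes> g)"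
    using g a l H normal.rcos_sum[OF normal[OF H]] by (simp add: mult_completion)
  moreover have "(embed k \<otimes>\<^bsub>profinite_completion G \<H>\<^esub> x) H = H #> (a \<otimes> g)"
    using g a H normal.rcos_sum[OF normal[OF H]] embed_coset[where k=k, OF H a] by (simp add: mult_completion)
  then have "act l (embed k \<otimes>\<^bsub>profinite_completion G \<H>\<^esub> x) H = H #> (l \<otimes> (a \<otimes> g))"
    using g a by (intro action_coset[OF l kx H]) auto
  ultimately show "(embed (act_L l k) \<otimes>\<^bsub>profinite_completion G \<H>\<^esub> x) H =
      act l (embed k \<otimes>\<^bsub>profinite_completion G \<H>\<^esub> x) H"
    using l a g by (simp add: m_assoc)
qed

lemma free_act: "free_measurable_action (G\<lparr>carrier := L\<rparr>) act \<mu>"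
  using L.subgroup_axioms by (rule free_measurable_action_subgroup)

lemma free_act_L: "free_measurable_action (G\<lparr>carrier := L\<rparr>) act_L \<nu>"
  using closure.free_measurable_action_subgroup[OF closure.subgroup_self] by simp

text \<open>The family is \<open>embed k\<close> times \<open>x\<close>: equivariant in
  \<open>k\<close> by the preceding lemma, and measure preserving in \<open>x\<close> as a left
  translation.\<close>

theorem cost_closure_le: "cost (G\<lparr>carrier := L\<rparr>) act_L \<nu> \<le> cost (G\<lparr>carrier := L\<rparr>) act \<mu>"
proof (rule cost_le_of_equivariant_family)
  let ?a = "\<lambda>k x. embed k \<otimes>\<^bsub>profinite_completion G \<H>\<^esub> x"
  note embed_measurable[measurable]
  have "(\<lambda>p. (embed (fst p), snd p)) \<in> \<nu> \<Otimes>\<^sub>M \<mu> \<rightarrow>\<^sub>M \<mu> \<Otimes>\<^sub>M \<mu>"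
    by measurable
  from measurable_compose[OF this mult_measurable]
  show "(\<lambda>p. ?a (fst p) (snd p)) \<in> \<nu> \<Otimes>\<^sub>M \<mu> \<rightarrow>\<^sub>M \<mu>" by simp
  fix k assume "k \<in> space \<nu>"
  then show "distr \<mu> \<mu> (?a k) = \<mu>"
    using embed_closed by (intro distr_mult_left) (simp add: closure.space_haar)
next
  fix x assume x: "x \<in> space \<mu>"
  have "(\<lambda>k. (embed k, x)) \<in> \<nu> \<rightarrow>\<^sub>M \<mu> \<Otimes>\<^sub>M \<mu>"
    using embed_measurable x by measurable
  from measurable_compose[OF this mult_measurable]
  show "equivariant_map (G\<lparr>carrier := L\<rparr>) act_L \<nu> act \<mu> (\<lambda>k. embed k \<otimes>\<^bsub>profinite_completion G \<H>\<^esub> x)"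
    using x embed_act
    by (intro equivariant_map.intro free_act free_act_L equivariant_map_axioms.intro)
       (simp_all add: space_haar closure.space_haar)
qed (fact prob_space_axioms closure.prob_space_axioms)+

section \<open>A section of the orbit map, built along a cofinal chain\<close>

definition chain :: "nat \<Rightarrow> 'a set" where
  "chain n = \<Inter>(from_nat_into \<H> ` {..n})"

lemma chain_in: "chain n \<in> \<H>"
  unfolding chain_def using from_nat_into[OF nonempty] by (intro Inter_in) auto

lemma chain_antimono: "m \<le> n \<Longrightarrow> chain n \<subseteq> chain m"
  by (auto simp: chain_def)

lemma chain_cofinal:
  assumes "H \<in> \<H>"
  shows "\<exists>n. chain n \<subseteq> H"
proof -
  obtain n where "from_nat_into \<H> n = H"
    using from_nat_into_surj[OF countable assms] by blast
  then show ?thesis unfolding chain_def by blast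
qed

text \<open>The choice of a representative depends only on the orbit of the coset under \<open>L\<close>, and
  successive choices are compatible, so that in the limit they form a section of the
  orbit map of the closure of \<open>L\<close>.\<close>

primrec orbit_rep :: "nat \<Rightarrow> 'a set \<Rightarrow> 'a" where
  "orbit_rep 0 c = (SOME g. g \<in> carrier G \<and> (\<exists>l\<in>L. chain 0 #> (l \<otimes> g) = c))"
| "orbit_rep (Suc n) c = (SOME g. g \<in> carrier G \<and> (\<exists>l\<in>L. chain (Suc n) #> (l \<otimes> g) = c) \<and>
     chain n #> g = chain n #> orbit_rep n (chain n <#> c))"

declare orbit_rep.simps [simp del]

abbreviation "section n x \<equiv> orbit_rep n (x (chain n))"

lemma chain_Suc_mult: "x \<in> X \<Longrightarrow> chain n <#> x (chain (Suc n)) = x (chain n)"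
  using completion_compatible[of x "chain (Suc n)" "chain n"] chain_in chain_antimono[of n "Suc n"]
  by simp

text \<open>These are the existence claims behind the choices in \<open>orbit_rep\<close>: a
  representative at one level can always be refined at the next without leaving the orbit of the
  coset.\<close>

lemma section_props:
  assumes x: "x \<in> X"
  shows "section n x \<in> carrier G \<and> (\<exists>l\<in>L. chain n #> (l \<otimes> section n x) = x (chain n))"
    and "chain n #> section (Suc n) x = chain n #> section n x"
proof -
  let ?P = "\<lambda>n g. g \<in> carrier G \<and> (\<exists>l\<in>L. chain n #> (l \<otimes> g) = x (chain n))"
  have step: "?P (Suc n) (section (Suc n) x) \<and> chain n #> section (Suc n) x = chain n #> section n x"
    if IH: "?P n (section n x)" for n
  proof -
    obtain l where l: "l \<in> L" "chain n #> (l \<otimes> section n x) = x (chain n)" using IH by blast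
    obtain h where h: "h \<in> carrier G" "\<And>M. M \<in> \<H> \<Longrightarrow> chain (Suc n) \<subseteq> M \<Longrightarrow> x M = M #> h"
      using completion_rep[OF x chain_in[of "Suc n"]] by blast
    have xh: "x (chain (Suc n)) = chain (Suc n) #> h" "x (chain n) = chain n #> h"
      using h(2) chain_in chain_antimono[of n "Suc n"] by auto
    \<comment> \<open>\<open>h\<close> represents \<open>x\<close> at level \<open>Suc n\<close>.
      Undoing the displacement \<open>l\<close> found at level \<open>n\<close> keeps it in the same
      orbit and makes it agree with the previous choice modulo \<open>chain n\<close>.\<close>
    let ?g = "inv l \<otimes> h"
    have lc: "l \<in> carrier G" using l by auto
    have "l \<otimes> ?g = h" using lc h by (simp add: m_assoc[symmetric])
    moreover have "chain n #> ?g = chain n #> (inv l \<otimes> (l \<otimes> section n x))"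
      using l(2) xh lc h(1) IH by (intro shift_coset chain_in) auto
    moreover have "inv l \<otimes> (l \<otimes> section n x) = section n x"
      using lc IH by (simp add: m_assoc[symmetric])
    ultimately have "\<exists>g. g \<in> carrier G \<and> (\<exists>l\<in>L. chain (Suc n) #> (l \<otimes> g) = x (chain (Suc n))) \<and>
        chain n #> g = chain n #> section n x"
      using l(1) lc h(1) xh by (metis inv_closed m_closed)
    from someI_ex[OF this] show ?thesis
      unfolding orbit_rep.simps(2) chain_Suc_mult[OF x] by blast
  qed
  have base: "?P 0 (section 0 x)"
  proof -
    obtain h where h: "h \<in> carrier G" "x (chain 0) = chain 0 #> h"
      using completion_rep_coset[OF x chain_in] by blast
    then have "chain 0 #> (\<one> \<otimes> h) = x (chain 0)" by simp
    then have "\<exists>g. ?P 0 g" using h(1) L.one_closed by blast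
    from someI_ex[OF this] show ?thesis unfolding orbit_rep.simps(1) .
  qed
  have P: "?P n (section n x)" for n
    by (induction n) (use base step in blast)+
  show "?P n (section n x)" by (rule P)
  show "chain n #> section (Suc n) x = chain n #> section n x"
    using step[OF P] by blast
qed

lemma section_carrier: "x \<in> X \<Longrightarrow> section n x \<in> carrier G"
  using section_props(1) by blast

text \<open>Acting by \<open>l\<close> only replaces the witness \<open>m\<close> by
  \<open>l \<otimes> m\<close>, so the predicates under the choice operator are equal for
  \<open>x\<close> and its translate, and so are the chosen elements.\<close>

lemma section_act:
  assumes x: "x \<in> X" and l: "l \<in> L"
  shows "section n (act l x) = section n x"
proof -
  have lc: "l \<in> carrier G" using l by auto
  have lx: "act l x \<in> X" using x lc by (rule action_closed[rotated])
  have eq: "(\<exists>m\<in>L. chain n #> (m \<otimes> g) = act l x (chain n)) \<longleftrightarrow> (\<exists>m\<in>L. chain n #> (m \<otimes> g) = x (chain n))"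
    if g: "g \<in> carrier G" for g n
  proof -
    obtain h where h: "h \<in> carrier G" "x (chain n) = chain n #> h"
      using completion_rep_coset[OF x chain_in] by blast
    have lh: "act l x (chain n) = chain n #> (l \<otimes> h)"
      using action_coset[OF lc x chain_in h] .
    show ?thesis
    proof
      assume "\<exists>m\<in>L. chain n #> (m \<otimes> g) = act l x (chain n)"
      then obtain m where m: "m \<in> L" "chain n #> (m \<otimes> g) = chain n #> (l \<otimes> h)" using lh by auto
      then have "chain n #> (inv l \<otimes> (m \<otimes> g)) = chain n #> (inv l \<otimes> (l \<otimes> h))"
        using lc h g by (intro shift_coset chain_in) auto
      moreover have "inv l \<otimes> (m \<otimes> g) = (inv l \<otimes> m) \<otimes> g" "inv l \<otimes> (l \<otimes> h) = h"
        using lc h g m(1) by (auto simp: m_assoc[symmetric])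
      ultimately have "chain n #> ((inv l \<otimes> m) \<otimes> g) = x (chain n)" using h by simp
      then show "\<exists>m\<in>L. chain n #> (m \<otimes> g) = x (chain n)" using l m(1) by blast
    next
      assume "\<exists>m\<in>L. chain n #> (m \<otimes> g) = x (chain n)"
      then obtain m where m: "m \<in> L" "chain n #> (m \<otimes> g) = chain n #> h" using h by auto
      then have "chain n #> (l \<otimes> (m \<otimes> g)) = chain n #> (l \<otimes> h)"
        using lc h g by (intro shift_coset chain_in) auto
      then have "chain n #> ((l \<otimes> m) \<otimes> g) = act l x (chain n)"
        using lh lc g m(1) by (simp add: m_assoc)
      then show "\<exists>m\<in>L. chain n #> (m \<otimes> g) = act l x (chain n)" using l m(1) by blast
    qed
  qed
  show ?thesis
  proof (induction n)
    case 0
    show ?case unfolding orbit_rep.simps(1) using eq by (intro arg_cong[where f=Eps] ext) blast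
  next
    case (Suc n)
    show ?case
      unfolding orbit_rep.simps(2) chain_Suc_mult[OF x] chain_Suc_mult[OF lx] Suc.IH
      using eq by (intro arg_cong[where f=Eps] ext) blast
  qed
qed

text \<open>Let s(x) be the limit of the sections. This set approximates, at level \<open>n\<close>,
  the unique k in the closure of \<open>L\<close> with x = k s(x).\<close>

definition displacement :: "nat \<Rightarrow> 'a set \<Rightarrow> 'a set" where
  "displacement n c = {a \<in> L. chain n #> (a \<otimes> orbit_rep n c) = c}"

lemma displacement_nonempty: "x \<in> X \<Longrightarrow> \<exists>a. a \<in> displacement n (x (chain n))"
  using section_props(1)[of x n] by (auto simp: displacement_def)

text \<open>The representative cancels in
  \<open>(b \<otimes> r) \<otimes> inv (a \<otimes> r)\<close>, so two displacements differ by an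
  element of \<open>L \<inter> chain n\<close>.\<close>

lemma displacement_coset:
  assumes x: "x \<in> X" and a: "a \<in> displacement n (x (chain n))"
  shows "displacement n (x (chain n)) = (L \<inter> chain n) #> a"
proof -
  let ?r = "section n x"
  have r: "?r \<in> carrier G" by (rule section_carrier[OF x])
  have aL: "a \<in> L" and ax: "chain n #> (a \<otimes> ?r) = x (chain n)"
    using a by (auto simp: displacement_def)
  have "chain n #> (b \<otimes> ?r) = chain n #> (a \<otimes> ?r) \<longleftrightarrow> b \<in> chain n #> a" if b: "b \<in> L" for b
  proof -
    have "(b \<otimes> ?r) \<otimes> inv (a \<otimes> ?r) = b \<otimes> inv a"
      using aL b r by (simp add: inv_mult_group m_assoc) (simp add: m_assoc[symmetric])
    then show ?thesis
      using aL b r subgrp[OF chain_in[of n]] by (simp add: rcos_eq_iff mem_rcos_iff)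
  qed
  then have "displacement n (x (chain n)) = L \<inter> (chain n #> a)"
    unfolding displacement_def ax by auto
  then show ?thesis
    using subgroup_Int_rcos[OF L.subgroup_axioms subgrp[OF chain_in] aL] by simp
qed

text \<open>The equation defining a displacement at level \<open>Suc n\<close> passes to level
  \<open>n\<close>, where the two sections agree.\<close>

lemma displacement_antimono:
  assumes x: "x \<in> X" and "m \<le> n"
  shows "displacement n (x (chain n)) \<subseteq> displacement m (x (chain m))"
  using \<open>m \<le> n\<close>
proof (induction rule: dec_induct)
  case (step n)
  have "displacement (Suc n) (x (chain (Suc n))) \<subseteq> displacement n (x (chain n))"
  proof
    fix a assume "a \<in> displacement (Suc n) (x (chain (Suc n)))"
    then have a: "a \<in> L" "chain (Suc n) #> (a \<otimes> section (Suc n) x) = x (chain (Suc n))"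
      by (auto simp: displacement_def)
    note r = section_carrier[OF x]
    have "x (chain n) = chain n <#> (chain (Suc n) #> (a \<otimes> section (Suc n) x))"
      using a chain_Suc_mult[OF x] by simp
    also have "\<dots> = chain n #> (a \<otimes> section (Suc n) x)"
      using a r chain_antimono[of n "Suc n"] by (intro set_mult_coset chain_in) auto
    also have "\<dots> = chain n #> (a \<otimes> section n x)"
      using a r section_props(2)[OF x] by (intro shift_coset chain_in) auto
    finally show "a \<in> displacement n (x (chain n))" using a by (simp add: displacement_def)
  qed
  then show ?case using step by blast
qed simp

section \<open>The equivariant projection onto the completion of the subgroup\<close>

definition index :: "'a set \<Rightarrow> nat" where
  "index M = (LEAST n. L \<inter> chain n \<subseteq> M)"

text \<open>The map sending x = k s(x) to k. The same \<open>M\<close> may be the trace of several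
  members of the lattice, so the level at which its coordinate is read off is computed from
  \<open>M\<close> alone.\<close>

definition project :: "('a set \<Rightarrow> 'a set) \<Rightarrow> ('a set \<Rightarrow> 'a set)" where
  "project x = (\<lambda>M\<in>(\<inter>) L ` \<H>. M <#> displacement (index M) (x (chain (index M))))"

lemma index:
  assumes "M \<in> (\<inter>) L ` \<H>"
  shows "L \<inter> chain (index M) \<subseteq> M"
proof -
  have "\<exists>n. L \<inter> chain n \<subseteq> M" using assms chain_cofinal by blast
  then show ?thesis unfolding index_def by (rule LeastI_ex)
qed

text \<open>Displacements shrink along the chain, so any level whose trace lies in \<open>M\<close>
  computes the coordinate at \<open>M\<close>, not only the least one.\<close>

lemma project_coset:
  assumes x: "x \<in> X" and M: "M \<in> (\<inter>) L ` \<H>" "L \<inter> chain n \<subseteq> M"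
    and a: "a \<in> displacement n (x (chain n))"
  shows "project x M = M #> a"
proof -
  have "index M \<le> n" unfolding index_def using M(2) by (rule Least_le)
  then have "a \<in> displacement (index M) (x (chain (index M)))"
    using displacement_antimono[OF x] a by blast
  from displacement_coset[OF x this]
  have "project x M = M <#> ((L \<inter> chain (index M)) #> a)"
    using M(1) by (simp add: project_def)
  also have "\<dots> = M #> a"
  proof (rule set_mult_rcos)
    show "subgroup M G" using M(1) trace_subgroup by blast
    show "L \<inter> chain (index M) \<subseteq> M" by (rule index[OF M(1)])
    show "\<one> \<in> L \<inter> chain (index M)"
      using subgroup.one_closed[OF trace_subgroup[OF chain_in]] .
    show "a \<in> carrier G" using a by (auto simp: displacement_def)
  qed
  finally show ?thesis .
qed

lemma project_closed:
  assumes x: "x \<in> X"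
  shows "project x \<in> closure.X"
proof (rule closure.completionI)
  fix N assume N: "N \<in> (\<inter>) L ` \<H>"
  obtain a where a: "a \<in> displacement (index N) (x (chain (index N)))"
    using displacement_nonempty[OF x] by blast
  have "project x M = M #> a" if "M \<in> (\<inter>) L ` \<H>" "N \<subseteq> M" for M
    using project_coset[OF x that(1) _ a] index[OF N] that(2) by blast
  then show "\<exists>g\<in>carrier (G\<lparr>carrier := L\<rparr>). \<forall>M\<in>(\<inter>) L ` \<H>. N \<subseteq> M \<longrightarrow>
      project x M = M #>\<^bsub>G\<lparr>carrier := L\<rparr>\<^esub> g"
    using a by (auto simp: displacement_def)
qed (simp add: project_def)

text \<open>The section is constant on orbits, so translating \<open>x\<close> by \<open>l\<close>
  multiplies its displacements by \<open>l\<close> on the left.\<close>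

lemma project_act:
  assumes x: "x \<in> X" and l: "l \<in> L"
  shows "project (act l x) = act_L l (project x)"
proof (rule closure.completion_eqI)
  have lc: "l \<in> carrier G" using l by auto
  have lx: "act l x \<in> X" using x lc by (rule action_closed[rotated])
  show "project (act l x) \<in> closure.X" using lx by (rule project_closed)
  show "act_L l (project x) \<in> closure.X"
    using l project_closed[OF x] by (intro closure.action_closed) auto
  fix M assume M: "M \<in> (\<inter>) L ` \<H>"
  let ?n = "index M"
  obtain a where a: "a \<in> displacement ?n (x (chain ?n))"
    using displacement_nonempty[OF x] by blast
  then have aL: "a \<in> L" and ax: "x (chain ?n) = chain ?n #> (a \<otimes> section ?n x)"
    by (auto simp: displacement_def)
  have r: "section ?n x \<in> carrier G" by (rule section_carrier[OF x])
  have "act l x (chain ?n) = chain ?n #> (l \<otimes> (a \<otimes> section ?n x))"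
    using aL r by (intro action_coset[OF lc x chain_in _ ax]) auto
  then have "l \<otimes> a \<in> displacement ?n (act l x (chain ?n))"
    using l aL r lc section_act[OF x l, of ?n] by (simp add: displacement_def m_assoc)
  then have "project (act l x) M = M #> (l \<otimes> a)"
    by (rule project_coset[OF lx M index[OF M]])
  also have "\<dots> = act_L l (project x) M"
    using closure.action_coset[OF _ project_closed[OF x] M, of l a] l aL
      project_coset[OF x M index[OF M] a] by simp
  finally show "project (act l x) M = act_L l (project x) M" .
qed

lemma project_measurable: "project \<in> \<mu> \<rightarrow>\<^sub>M \<nu>"
proof (rule closure.measurable_haarI)
  fix M assume M: "M \<in> (\<inter>) L ` \<H>"
  let ?n = "index M"
  have "M <#> displacement ?n c \<in> rcosets\<^bsub>G\<lparr>carrier := L\<rparr>\<^esub> M" if "c \<in> rcosets (chain ?n)" for c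
  proof -
    \<comment> \<open>Every coset is a coordinate of the image of a group element, so the claim is
      inherited from \<open>project_closed\<close>.\<close>
    obtain g where g: "g \<in> carrier G" "c = chain ?n #> g" using \<open>c \<in> _\<close> by (auto simp: RCOSETS_def)
    then have "project (to_completion G \<H> g) M = M <#> displacement ?n c"
      using M chain_in by (simp add: project_def to_completion_def)
    then show ?thesis
      using closure.completion_rcosets[OF project_closed[OF to_completion_closed[OF g(1)]] M] by simp
  qed
  then have "(\<lambda>c. M <#> displacement ?n c) \<in>
      count_space (rcosets (chain ?n)) \<rightarrow>\<^sub>M count_space (rcosets\<^bsub>G\<lparr>carrier := L\<rparr>\<^esub> M)"
    by auto
  from measurable_compose[OF coordinate_measurable[OF chain_in] this]
  show "(\<lambda>x. project x M) \<in> \<mu> \<rightarrow>\<^sub>M count_space (rcosets\<^bsub>G\<lparr>carrier := L\<rparr>\<^esub> M)"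
    using M by (simp add: project_def)
qed (simp add: project_closed space_haar)

text \<open>The image measure is invariant under \<open>L\<close> because \<open>project\<close> is
  equivariant and \<mu> is invariant; uniqueness of the invariant probability measure identifies
  it.\<close>

lemma distr_project: "distr \<mu> \<nu> project = \<nu>"
proof (rule closure.invariant_prob_unique)
  show "prob_space (distr \<mu> \<nu> project)"
    using project_measurable by (rule prob_space_distr)
  fix l assume "l \<in> carrier (G\<lparr>carrier := L\<rparr>)"
  then have l: "l \<in> L" "l \<in> carrier (G\<lparr>carrier := L\<rparr>)" "l \<in> carrier G" by auto
  have "distr (distr \<mu> \<nu> project) (distr \<mu> \<nu> project) (act_L l) = distr (distr \<mu> \<nu> project) \<nu> (act_L l)"
    by (rule distr_cong) auto
  also have "\<dots> = distr \<mu> \<nu> (act_L l \<circ> project)"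
    using closure.action_measurable[OF l(2)] project_measurable by (rule distr_distr)
  also have "\<dots> = distr \<mu> \<nu> (project \<circ> act l)"
    using project_act l by (intro distr_cong) (auto simp: space_haar)
  also have "\<dots> = distr (distr \<mu> \<mu> (act l)) \<nu> project"
    using project_measurable action_measurable[OF l(3)] by (rule distr_distr[symmetric])
  also have "\<dots> = distr \<mu> \<nu> project" by (simp add: distr_action[OF l(3)])
  finally show "distr (distr \<mu> \<nu> project) (distr \<mu> \<nu> project) (act_L l) = distr \<mu> \<nu> project" .
qed simp

theorem cost_le_closure: "cost (G\<lparr>carrier := L\<rparr>) act \<mu> \<le> cost (G\<lparr>carrier := L\<rparr>) act_L \<nu>"
proof -
  interpret equivariant_map "G\<lparr>carrier := L\<rparr>" act \<mu> act_L \<nu> project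
    using project_act project_measurable
    by (intro equivariant_map.intro free_act free_act_L equivariant_map_axioms.intro)
       (simp_all add: space_haar)
  show ?thesis using distr_project by (rule cost_le_of_measure_preserving)
qed

end

text \<open>Without coordinates the only possible point is the constant \<open>undefined\<close>
  function, so total mass 1 determines the measure. This settles the case excluded from
  \<open>normal_lattice\<close>.\<close>

lemma haar_empty_lattice_unique:
  assumes "normalized_haar_measure K (profinite_topology G {}) \<mu>"
    and "normalized_haar_measure K' (profinite_topology G {}) \<nu>"
  shows "\<mu> = \<nu>"
proof (rule measure_eqI)
  show sets: "sets \<mu> = sets \<nu>"
    using assms by (simp add: normalized_haar_measure_def)
  fix A assume A: "A \<in> sets \<mu>"
  have "topspace (profinite_topology G {}) \<subseteq> {\<lambda>_. undefined}"
    by (auto simp: profinite_topology_def)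
  then have sp: "space \<mu> \<subseteq> {\<lambda>_. undefined}" "space \<nu> = space \<mu>"
    using assms by (auto simp: normalized_haar_measure_def)
  have "A \<subseteq> space \<mu>" using A by (rule sets.sets_into_space)
  then consider "A = {}" | "A = space \<mu>" using sp(1) by blast
  then show "emeasure \<mu> A = emeasure \<nu> A"
  proof cases
    case 2
    have "prob_space \<mu>" "prob_space \<nu>" using assms by (auto simp: normalized_haar_measure_def)
    then show ?thesis using 2 sp(2) by (metis prob_space.emeasure_space_1)
  qed simp
qed

theorem proposition1p3:
  fixes \<Gamma> :: "('a, 'b) monoid_scheme"
    and L :: "'a set"
    and \<H> :: "'a set set"
    and \<mu> \<nu> :: "('a set \<Rightarrow> 'a set) measure"
  assumes "finitely_generated_group \<Gamma>"
    and "subgroup L \<Gamma>"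
    and "subgroup_lattice \<Gamma> \<H>"
    and "\<And>H. H \<in> \<H> \<Longrightarrow> H \<lhd> \<Gamma>"
    and "\<And>H. H \<in> \<H> \<Longrightarrow> finite_index \<Gamma> H"
    and "carrier \<Gamma> \<inter> \<Inter>\<H> = {\<one>\<^bsub>\<Gamma>\<^esub>}"
    and "normalized_haar_measure (profinite_completion \<Gamma> \<H>) (profinite_topology \<Gamma> \<H>) \<mu>"
    and "normalized_haar_measure
           (profinite_completion (\<Gamma>\<lparr>carrier := L\<rparr>) ((\<lambda>H. L \<inter> H) ` \<H>))
           (profinite_topology (\<Gamma>\<lparr>carrier := L\<rparr>) ((\<lambda>H. L \<inter> H) ` \<H>)) \<nu>"
  shows "cost (\<Gamma>\<lparr>carrier := L\<rparr>) (completion_action \<Gamma> \<H>) \<mu> =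
         cost (\<Gamma>\<lparr>carrier := L\<rparr>)
           (completion_action (\<Gamma>\<lparr>carrier := L\<rparr>) ((\<lambda>H. L \<inter> H) ` \<H>)) \<nu>"
proof (cases "\<H> = {}")
  case True
  \<comment> \<open>The intersection of the empty family is everything, so the group is trivial and
    both sides are the same cost.\<close>
  then have "carrier \<Gamma> = {\<one>\<^bsub>\<Gamma>\<^esub>}" using assms(6) by simp
  then have "L = carrier \<Gamma>"
    using subgroup.subset[OF assms(2)] subgroup.one_closed[OF assms(2)] by auto
  then have \<Gamma>: "\<Gamma>\<lparr>carrier := L\<rparr> = \<Gamma>" by simp
  have "\<mu> = \<nu>"
    using assms(7,8) unfolding True \<Gamma> image_empty by (rule haar_empty_lattice_unique)
  then show ?thesis unfolding True \<Gamma> image_empty by simp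
next
  case False
  interpret \<Gamma>: group \<Gamma> using assms(1) by (simp add: finitely_generated_group_def)
  obtain S where "finite S" "generate \<Gamma> S = carrier \<Gamma>"
    using assms(1) by (auto simp: finitely_generated_group_def)
  then have "countable (carrier \<Gamma>)"
    using \<Gamma>.countable_generate[of S] by (simp add: countable_finite)
  moreover have "countable \<H>"
    using \<Gamma>.countable_finite_index_subgroups[OF assms(1)]
    by (rule countable_subset[rotated]) (use assms(4,5) normal_imp_subgroup in auto)
  ultimately interpret haar_lattice \<Gamma> \<H> \<mu>
    using assms False
    by (intro haar_lattice.intro normal_lattice.intro normal_lattice_axioms.intro
        haar_lattice_axioms.intro \<Gamma>.group_axioms)
  interpret closure: normal_lattice "\<Gamma>\<lparr>carrier := L\<rparr>" "(\<inter>) L ` \<H>"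
    using assms(2) by (rule restrict_subgroup)
  interpret closure: haar_lattice "\<Gamma>\<lparr>carrier := L\<rparr>" "(\<inter>) L ` \<H>" \<nu>
    using assms(8) by unfold_locales
  interpret subgroup_completion \<Gamma> \<H> \<mu> L \<nu>
    using assms(2) by (intro subgroup_completion.intro haar_lattice_axioms closure.haar_lattice_axioms)
  show ?thesis
    using cost_le_closure cost_closure_le by (rule antisym)
qed

end
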